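(* Let $\epsilon$ be a nonzero complex number or a nonzero surreal number, and let $n,k$ be integers. Then the Knuth coefficient $\left\lfloor {n \atop k} \right\rceil_{\bullet}^{\epsilon}$ satisfies the following. (Region 1) If $n\ge k\ge 0$, then $\left\lfloor {n \atop k} \right\rceil_{\bullet}^{\epsilon}=\binom{n}{k}=\left\lfloor {n \atop k} \right\rceil$. (Region 2) If $k\ge 0>n$, then $\left\lfloor {n \atop k} \right\rceil_{\bullet}^{\epsilon}=(-1)^k\binom{-n+k-1}{k}=\left\lfloor {n \atop k} \right\rceil$. (Region 3) If $0>n\ge k$, then $\left\lfloor {n \atop k} \right\rceil_{\bullet}^{\epsilon}=(-1)^{n+k}\binom{-k-1}{n-k}=\left\lfloor {n \atop k} \right\rceil$. (Region 4) If $k>n\ge 0$, then $\left\lfloor {n \atop k} \right\rceil_{\bullet}^{\epsilon}=\dfrac{(-1)^{n+k}\epsilon}{(n-k)\binom{k}{n}}=\epsilon\left\lfloor {n \atop k} \right\rceil$. (Region 5) If $n\ge 0>k$, then $\left\lfloor {n \atop k} \right\rceil_{\bullet}^{\epsilon}=\dfrac{(-1)^{k}\epsilon}{k\binom{n-k}{n}}=\epsilon\left\lfloor {n \atop k} \right\rceil$. (Region 6) If $0>k>n$, then $\left\lfloor {n \atop k} \right\rceil_{\bullet}^{\epsilon}=\dfrac{\epsilon}{k\binom{-n-1}{-k}}=\epsilon\left\lfloor {n \atop k} \right\rceil$.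
   Context: For a nonzero parameter $\epsilon$, put $\omega=1/\epsilon$. The Knuth factorial of a real number $a$ is $$\lfloor a\rceil_{\bullet}^{\epsilon}=\begin{cases}\Gamma(a+1)&\text{if } a \text{ is not a negative integer},\\ (-1)^{a-1}\,\omega/(-a-1)!&\text{if } a \text{ is a negative integer},\end{cases}$$ and the Knuth coefficient is $$\left\lfloor {a \atop b} \right\rceil_{\bullet}^{\epsilon}=\frac{\lfloor a\rceil_{\bullet}^{\epsilon}}{\lfloor b\rceil_{\bullet}^{\epsilon}\,\lfloor a-b\rceil_{\bullet}^{\epsilon}}.$$ The Roman coefficient is the case $\epsilon=1$: $\left\lfloor {n \atop k} \right\rceil=\lfloor n\rceil!/(\lfloor k\rceil!\,\lfloor n-k\rceil!)$, where for an integer $n$, $\lfloor n\rceil!=n!$ if $n\ge 0$ and $\lfloor n\rceil!=(-1)^{n+1}/(-n-1)!$ if $n<0$. *)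

theory Defs
  imports "HOL-Analysis.Analysis" "HOL-Library.Infinite_Typeclass" "HOL-Library.Multiset"
begin

section \<open>Surreal numbers\<close>

text \<open>
  The surreal numbers form a proper class, so they are constructed relative to a size bound:
  a game has a set of left and a set of right options, each the range of a partial function on the
  index type \<open>'i\<close>. For an infinite index type, the games whose option sets have, hereditarily,
  cardinality at most that of \<open>'i\<close> are closed under Conway's operations, and the type
  \<open>'i surreal\<close> defined below consists of the surreals represented by such games, that is, the
  surreals whose birthday is smaller than the successor cardinal of the cardinality of \<open>'i\<close>.
  Every surreal number lies in such a field once the index set is large enough, and
  \<open>'i\<close> stays an arbitrary infinite type throughout.
\<close>

subsection \<open>Games\<close>

datatype 'i game = Game (left_fun: "'i \<Rightarrow> 'i game option") (right_fun: "'i \<Rightarrow> 'i game option")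

definition lopts :: "'i game \<Rightarrow> 'i game set" where
  "lopts x = ran (left_fun x)"

definition ropts :: "'i game \<Rightarrow> 'i game set" where
  "ropts x = ran (right_fun x)"

definition opts :: "'i game \<Rightarrow> 'i game set" where
  "opts x = lopts x \<union> ropts x"

definition option_rel :: "('i game \<times> 'i game) set" where
  "option_rel = {(a, x). a \<in> opts x}"

lemma opts_induct:
  assumes "\<And>x. (\<And>a. a \<in> opts x \<Longrightarrow> P a) \<Longrightarrow> P x"
  shows "P x"
proof (induction x)
  case (Game l r)
  show ?case
  proof (rule assms)
    fix a assume "a \<in> opts (Game l r)"
    then obtain i where "l i = Some a \<or> r i = Some a"
      by (auto simp: opts_def lopts_def ropts_def ran_def)
    then show "P a"
      using Game[of "Some a" a] by (metis option.set_intros rangeI)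
  qed
qed

lemma wf_option_rel: "wf (option_rel :: ('i game \<times> 'i game) set)"
proof (rule wfUNIVI)
  fix P :: "'i game \<Rightarrow> bool" and x :: "'i game"
  assume "\<forall>x. (\<forall>y. (y, x) \<in> option_rel \<longrightarrow> P y) \<longrightarrow> P x"
  then show "P x" by (induction x rule: opts_induct) (simp add: option_rel_def)
qed

lemma optsI: "a \<in> lopts x \<Longrightarrow> a \<in> opts x" "a \<in> ropts x \<Longrightarrow> a \<in> opts x"
  by (auto simp: opts_def)

text \<open>At most as many elements as the type \<open>'i\<close> has.\<close>

definition small :: "'i itself \<Rightarrow> 'b set \<Rightarrow> bool" where
  "small _ A \<longleftrightarrow> (\<exists>f :: 'i \<Rightarrow> 'b. A \<subseteq> range f)"

text \<open>The game \<open>{A | B}\<close>; meaningful only if \<open>A\<close> and \<open>B\<close> are small.\<close>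

definition mk_game :: "'i game set \<Rightarrow> 'i game set \<Rightarrow> 'i game" where
  "mk_game A B = Game (SOME l. ran l = A) (SOME r. ran r = B)"

lemma small_ran_ex:
  fixes A :: "'b set"
  assumes "small TYPE('i) A"
  shows "\<exists>l :: 'i \<Rightarrow> 'b option. ran l = A"
proof -
  obtain f :: "'i \<Rightarrow> 'b" where f: "A \<subseteq> range f" using assms by (auto simp: small_def)
  have "ran (\<lambda>i. if f i \<in> A then Some (f i) else None) = A"
    using f by (force simp: ran_def)
  then show ?thesis by blast
qed

lemma lopts_mk [simp]: "small TYPE('i) A \<Longrightarrow> lopts (mk_game A B :: 'i game) = A"
  unfolding mk_game_def lopts_def by (simp add: someI_ex[OF small_ran_ex])

lemma ropts_mk [simp]: "small TYPE('i) B \<Longrightarrow> ropts (mk_game A B :: 'i game) = B"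
  unfolding mk_game_def ropts_def by (simp add: someI_ex[OF small_ran_ex])

lemma small_ran: "small TYPE('i) (ran (f :: 'i \<Rightarrow> 'b option))"
  unfolding small_def
  by (rule exI[of _ "\<lambda>i. the (f i)"]) (auto simp: ran_def image_iff, metis option.sel)

lemma small_lopts [simp]: "small TYPE('i) (lopts (x :: 'i game))"
  and small_ropts [simp]: "small TYPE('i) (ropts (x :: 'i game))"
  by (simp_all add: lopts_def ropts_def small_ran)

lemma small_empty [simp]: "small TYPE('i) {}"
  by (simp add: small_def)

lemma small_insert [simp]: "small TYPE('i) {x}"
  unfolding small_def by (rule exI[of _ "\<lambda>_. x"]) auto

lemma small_subset: "small TYPE('i) B \<Longrightarrow> A \<subseteq> B \<Longrightarrow> small TYPE('i) A"
  by (meson small_def subset_trans)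

lemma small_image [simp]: "small TYPE('i) A \<Longrightarrow> small TYPE('i) (f ` A)"
  unfolding small_def by (metis image_mono image_image)

lemma small_via:
  assumes "A \<subseteq> f ` (UNIV :: 'c set)" "\<exists>g :: 'c \<Rightarrow> 'i. inj g"
  shows "small TYPE('i) A"
proof -
  obtain g :: "'c \<Rightarrow> 'i" where "inj g" using assms by blast
  then have "A \<subseteq> range (f \<circ> inv g)"
    using assms(1) by (metis image_comp inj_imp_surj_inv)
  then show ?thesis unfolding small_def by blast
qed

lemma inj_prod: "\<exists>g :: 'i::infinite \<times> 'i \<Rightarrow> 'i. inj g"
proof -
  have "\<exists>f. bij_betw f ((UNIV :: 'i set) \<times> (UNIV :: 'i set)) (UNIV :: 'i set)"
    using card_of_Times_same_infinite[OF infinite_UNIV] by (simp only: card_of_ordIso)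
  then show ?thesis by (metis UNIV_Times_UNIV bij_betw_def)
qed

lemma inj_sum: "\<exists>g :: 'i::infinite + 'i \<Rightarrow> 'i. inj g"
proof -
  obtain h :: "'i \<times> 'i \<Rightarrow> 'i" where h: "inj h" using inj_prod by blast
  obtain a b :: 'i where ab: "a \<noteq> b" using arb_element[of "{undefined}"] by blast
  show ?thesis
    by (rule exI[of _ "case_sum (\<lambda>x. h (a, x)) (\<lambda>x. h (b, x))"])
       (use ab in \<open>auto intro!: injI simp: inj_eq[OF h] split: sum.splits\<close>)
qed

lemma small_Un [simp]:
  assumes "small TYPE('i::infinite) A" "small TYPE('i) B"
  shows "small TYPE('i) (A \<union> B)"
proof -
  obtain f :: "'i \<Rightarrow> _" where f: "A \<subseteq> range f" using assms by (auto simp: small_def)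
  obtain g :: "'i \<Rightarrow> _" where g: "B \<subseteq> range g" using assms by (auto simp: small_def)
  show ?thesis
  proof (rule small_via[where f = "case_sum f g", OF _ inj_sum])
    show "A \<union> B \<subseteq> range (case_sum f g)"
    proof
      fix x assume "x \<in> A \<union> B"
      then consider i where "x = f i" | i where "x = g i" using f g by blast
      then show "x \<in> range (case_sum f g)"
        by cases (metis old.sum.simps(5) rangeI, metis old.sum.simps(6) rangeI)
    qed
  qed
qed

lemma small_Times [simp]:
  assumes "small TYPE('i::infinite) A" "small TYPE('i) B"
  shows "small TYPE('i) (A \<times> B)"
proof -
  obtain f :: "'i \<Rightarrow> _" where f: "A \<subseteq> range f" using assms by (auto simp: small_def)
  obtain g :: "'i \<Rightarrow> _" where g: "B \<subseteq> range g" using assms by (auto simp: small_def)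
  have "A \<times> B \<subseteq> range f \<times> range g" using f g by (rule Sigma_mono)
  also have "\<dots> = range (map_prod f g)" by (metis UNIV_Times_UNIV map_prod_surj_on)
  finally show ?thesis by (rule small_via[OF _ inj_prod])
qed

lemma small_countable:
  assumes "countable A" shows "small TYPE('i::infinite) A"
proof (cases "A = {}")
  case False
  have "\<exists>g :: nat \<Rightarrow> 'i. inj g"
    using infinite_countable_subset[OF infinite_UNIV] by blast
  then show ?thesis
    using assms False by (intro small_via[where f = "from_nat_into A"]) (auto simp: range_from_nat_into)
qed auto


subsection \<open>Order\<close>

lemma mult_opt1:
  "a \<in> opts x \<Longrightarrow> ({#a#} + M, {#x#} + M) \<in> mult option_rel"
  by (subst (1 2) add.commute) (rule one_step_implies_mult, auto simp: option_rel_def)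

text \<open>Conway's order: \<open>x \<le> y\<close> iff no left option of \<open>x\<close> is \<open>\<ge> y\<close> and no right option of \<open>y\<close>
  is \<open>\<le> x\<close>.\<close>

function game_le :: "'i game \<Rightarrow> 'i game \<Rightarrow> bool" where
  "game_le x y \<longleftrightarrow> (\<forall>a\<in>lopts x. \<not> game_le y a) \<and> (\<forall>b\<in>ropts y. \<not> game_le b x)"
  by auto
termination
proof (relation "inv_image (mult option_rel) (\<lambda>(x, y). {#x, y#})", goal_cases)
  case 1 show ?case by (intro wf_inv_image wf_mult wf_option_rel)
next
  case (2 x y a)
  then have "({#a#} + {#y#}, {#x#} + {#y#}) \<in> mult option_rel"
    by (intro mult_opt1) (simp add: optsI)
  then show ?case by (simp add: add_mset_commute)
next
  case (3 x y b)
  then have "({#b#} + {#x#}, {#y#} + {#x#}) \<in> mult option_rel"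
    by (intro mult_opt1) (simp add: optsI)
  then show ?case by (simp add: add_mset_commute)
qed

declare game_le.simps [simp del]

instantiation game :: (type) preorder
begin

definition less_eq_game :: "'a game \<Rightarrow> 'a game \<Rightarrow> bool" where
  "x \<le> y \<longleftrightarrow> game_le x y"

definition less_game :: "'a game \<Rightarrow> 'a game \<Rightarrow> bool" where
  "x < y \<longleftrightarrow> x \<le> y \<and> \<not> y \<le> (x :: 'a game)"

lemma game_le_iff:
  "x \<le> y \<longleftrightarrow> (\<forall>a\<in>lopts x. \<not> y \<le> a) \<and> (\<forall>b\<in>ropts y. \<not> b \<le> (x :: 'a game))"
  unfolding less_eq_game_def by (rule game_le.simps)

lemma game_refl: "x \<le> (x :: 'a game)"
proof (induction x rule: opts_induct)
  case (1 x)
  have "\<not> x \<le> a" if "a \<in> lopts x" for a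
    using 1[of a] that by (subst game_le_iff) (auto simp: optsI)
  moreover have "\<not> b \<le> x" if "b \<in> ropts x" for b
    using 1[of b] that by (subst game_le_iff) (auto simp: optsI)
  ultimately show ?case by (subst game_le_iff) auto
qed

lemma game_trans_aux: "M = {#x, y, z#} \<Longrightarrow> x \<le> y \<Longrightarrow> y \<le> z \<Longrightarrow> x \<le> (z :: 'a game)"
proof (induction M arbitrary: x y z rule: wf_induct_rule[OF wf_mult[OF wf_option_rel]])
  case (1 M)
  have "\<not> z \<le> a" if "a \<in> lopts x" for a
  proof
    assume "z \<le> a"
    have "({#a#} + {#y, z#}, {#x#} + {#y, z#}) \<in> mult option_rel"
      using that by (intro mult_opt1) (simp add: optsI)
    then have "({#y, z, a#}, M) \<in> mult option_rel"
      using 1(2) by (simp add: add_mset_commute)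
    then have "y \<le> a" using 1(1)[OF _ refl] 1(4) \<open>z \<le> a\<close> by blast
    then show False using 1(3) that by (subst (asm) (2) game_le_iff) auto
  qed
  moreover have "\<not> b \<le> x" if "b \<in> ropts z" for b
  proof
    assume "b \<le> x"
    have "({#b#} + {#x, y#}, {#z#} + {#x, y#}) \<in> mult option_rel"
      using that by (intro mult_opt1) (simp add: optsI)
    then have "({#b, x, y#}, M) \<in> mult option_rel"
      using 1(2) by (simp add: add_mset_commute)
    then have "b \<le> y" using 1(1)[OF _ refl] 1(3) \<open>b \<le> x\<close> by blast
    then show False using 1(4) that by (subst (asm) (2) game_le_iff) auto
  qed
  ultimately show ?case by (subst game_le_iff) auto
qed

instance
  by standard (auto simp: less_game_def game_refl intro: game_trans_aux)

end

lemma lopt_lf: "a \<in> lopts x \<Longrightarrow> \<not> x \<le> a"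
  and ropt_lf: "b \<in> ropts x \<Longrightarrow> \<not> b \<le> x"
  using order_refl[of x] unfolding game_le_iff[of x x] by blast+

subsection \<open>Numbers among the games\<close>

inductive numeric :: "'i game \<Rightarrow> bool" where
  "(\<And>a. a \<in> opts x \<Longrightarrow> numeric a) \<Longrightarrow>
   (\<And>a b. a \<in> lopts x \<Longrightarrow> b \<in> ropts x \<Longrightarrow> \<not> b \<le> a) \<Longrightarrow> numeric x"

lemma numeric_opts: "numeric x \<Longrightarrow> a \<in> opts x \<Longrightarrow> numeric a"
  by (auto elim: numeric.cases)

lemma numeric_lopts: "numeric x \<Longrightarrow> a \<in> lopts x \<Longrightarrow> numeric a"
  and numeric_ropts: "numeric x \<Longrightarrow> a \<in> ropts x \<Longrightarrow> numeric a"
  by (auto intro: numeric_opts optsI)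

lemma numeric_lr: "numeric x \<Longrightarrow> a \<in> lopts x \<Longrightarrow> b \<in> ropts x \<Longrightarrow> \<not> b \<le> a"
  by (auto elim: numeric.cases)

lemma numeric_opt_le: "numeric x \<Longrightarrow> (\<forall>a\<in>lopts x. a \<le> x) \<and> (\<forall>b\<in>ropts x. x \<le> b)"
proof (induction x rule: opts_induct)
  case (1 x)
  have "a \<le> x" if a: "a \<in> lopts x" for a
  proof (subst game_le_iff, intro conjI ballI notI)
    fix a' assume "a' \<in> lopts a" "x \<le> a'"
    then have "x \<le> a" using 1(1)[of a] numeric_lopts[OF 1(2) a] a order_trans by (blast intro: optsI)
    then show False using lopt_lf[OF a] by simp
  qed (use a numeric_lr[OF 1(2)] in blast)
  moreover have "x \<le> b" if b: "b \<in> ropts x" for b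
  proof (subst game_le_iff, intro conjI ballI notI)
    fix b' assume "b' \<in> ropts b" "b' \<le> x"
    then have "b \<le> x" using 1(1)[of b] numeric_ropts[OF 1(2) b] b order_trans by (blast intro: optsI)
    then show False using ropt_lf[OF b] by simp
  qed (use b numeric_lr[OF 1(2)] in blast)
  ultimately show ?case by blast
qed

lemma numeric_lopt_le: "numeric x \<Longrightarrow> a \<in> lopts x \<Longrightarrow> a \<le> x"
  and numeric_ropt_ge: "numeric x \<Longrightarrow> b \<in> ropts x \<Longrightarrow> x \<le> b"
  using numeric_opt_le by blast+

lemma numeric_lopt_less: "numeric x \<Longrightarrow> a \<in> lopts x \<Longrightarrow> a < x"
  and numeric_ropt_less: "numeric x \<Longrightarrow> b \<in> ropts x \<Longrightarrow> x < b"
  by (auto simp: less_game_def numeric_lopt_le numeric_ropt_ge lopt_lf ropt_lf)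

lemma numeric_total: "numeric x \<Longrightarrow> numeric y \<Longrightarrow> x \<le> y \<or> y \<le> x"
  using game_le_iff[of x y] numeric_lopt_le[of x] numeric_ropt_ge[of y]
  by (meson order_trans)

lemma numeric_not_le: "numeric x \<Longrightarrow> numeric y \<Longrightarrow> \<not> x \<le> y \<longleftrightarrow> y < x"
  using numeric_total less_game_def by blast

subsection \<open>Addition\<close>

function game_add :: "'i game \<Rightarrow> 'i game \<Rightarrow> 'i game" where
  "game_add x y =
     mk_game ((\<lambda>a. game_add a y) ` lopts x \<union> (\<lambda>b. game_add x b) ` lopts y)
             ((\<lambda>a. game_add a y) ` ropts x \<union> (\<lambda>b. game_add x b) ` ropts y)"
  by auto
termination
proof (relation "inv_image (mult option_rel) (\<lambda>(x, y). {#x, y#})", goal_cases)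
  case 1 show ?case by (intro wf_inv_image wf_mult wf_option_rel)
next
  case (2 x y a)
  then show ?case using mult_opt1[of a x "{#y#}"] by (simp add: optsI add_mset_commute)
next
  case (3 x y b)
  then show ?case using mult_opt1[of b y "{#x#}"] by (simp add: optsI add_mset_commute)
next
  case (4 x y a)
  then show ?case using mult_opt1[of a x "{#y#}"] by (simp add: optsI add_mset_commute)
next
  case (5 x y b)
  then show ?case using mult_opt1[of b y "{#x#}"] by (simp add: optsI add_mset_commute)
qed

function game_neg :: "'i game \<Rightarrow> 'i game" where
  "game_neg x = mk_game (game_neg ` ropts x) (game_neg ` lopts x)"
  by auto
termination
proof (relation option_rel, goal_cases)
  case 1 show ?case by (rule wf_option_rel)
qed (simp_all add: option_rel_def optsI)

declare game_add.simps [simp del] game_neg.simps [simp del]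

instantiation game :: (type) "{plus, uminus, zero, one}"
begin
definition plus_game :: "'a game \<Rightarrow> 'a game \<Rightarrow> 'a game" where "plus_game = game_add"
definition uminus_game :: "'a game \<Rightarrow> 'a game" where "uminus_game = game_neg"
definition zero_game :: "'a game" where "zero_game = mk_game {} {}"
definition one_game :: "'a game" where "one_game = mk_game {0} {}"
instance ..
end

lemma lopts_add: "lopts (x + y :: 'i::infinite game) = (\<lambda>a. a + y) ` lopts x \<union> (\<lambda>b. x + b) ` lopts y"
  and ropts_add: "ropts (x + y :: 'i::infinite game) = (\<lambda>a. a + y) ` ropts x \<union> (\<lambda>b. x + b) ` ropts y"
  unfolding plus_game_def by (subst game_add.simps; simp)+

lemma lopts_neg: "lopts (- x :: 'i game) = uminus ` ropts x"
  and ropts_neg: "ropts (- x :: 'i game) = uminus ` lopts x"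
  unfolding uminus_game_def by (subst game_neg.simps; simp)+

lemma opts_zero [simp]: "lopts 0 = {}" "ropts 0 = {}"
  by (simp_all add: zero_game_def)

lemma opts_one [simp]: "lopts 1 = {0}" "ropts 1 = {}"
  by (simp_all add: one_game_def)

lemma game_pair_induct:
  assumes "\<And>x y :: 'i game. (\<And>a. a \<in> opts x \<Longrightarrow> P a y) \<Longrightarrow> (\<And>b. b \<in> opts y \<Longrightarrow> P x b) \<Longrightarrow> P x y"
  shows "P x y"
proof (induction x arbitrary: y rule: opts_induct)
  case (1 x y) note IHx = this
  show ?case
  proof (induction y rule: opts_induct)
    case (1 y) show ?case by (rule assms) (simp_all add: IHx 1)
  qed
qed

lemma game_add_unfold:
  "x + y = mk_game ((\<lambda>a. a + y) ` lopts x \<union> (\<lambda>b. x + b) ` lopts y)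
                   ((\<lambda>a. a + y) ` ropts x \<union> (\<lambda>b. x + b) ` ropts y)"
  unfolding plus_game_def by (subst game_add.simps) simp

lemma game_add_commute: "x + y = y + (x :: 'i game)"
proof (induction x y rule: game_pair_induct)
  case (1 x y)
  have "(\<lambda>a. a + y) ` lopts x = (\<lambda>a. y + a) ` lopts x" "(\<lambda>a. a + y) ` ropts x = (\<lambda>a. y + a) ` ropts x"
    "(\<lambda>b. x + b) ` lopts y = (\<lambda>b. b + x) ` lopts y" "(\<lambda>b. x + b) ` ropts y = (\<lambda>b. b + x) ` ropts y"
    using 1 by (auto simp: optsI intro!: image_cong)
  then show ?case by (subst (1 2) game_add_unfold) (simp add: Un_commute)
qed

lemma game_triple_induct:
  assumes "\<And>x y z :: 'i game. (\<And>a. a \<in> opts x \<Longrightarrow> P a y z) \<Longrightarrow> (\<And>b. b \<in> opts y \<Longrightarrow> P x b z)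
      \<Longrightarrow> (\<And>c. c \<in> opts z \<Longrightarrow> P x y c) \<Longrightarrow> P x y z"
  shows "P x y z"
proof (induction x arbitrary: y z rule: opts_induct)
  case (1 x y z) note IHx = this
  show ?case
  proof (induction y arbitrary: z rule: opts_induct)
    case (1 y z) note IHy = this
    show ?case
    proof (induction z rule: opts_induct)
      case (1 z) show ?case by (rule assms) (simp_all add: IHx IHy 1)
    qed
  qed
qed

lemma game_add_assoc: "(x + y) + z = x + (y + z :: 'i::infinite game)"
proof (induction x y z rule: game_triple_induct)
  case (1 x y z)
  have "(\<lambda>p. p + z) ` lopts (x + y) \<union> (\<lambda>c. x + y + c) ` lopts z =
        (\<lambda>a. a + (y + z)) ` lopts x \<union> (\<lambda>p. x + p) ` lopts (y + z)"
    using 1 by (auto simp: lopts_add image_Un image_image optsI cong: image_cong)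
  moreover have "(\<lambda>p. p + z) ` ropts (x + y) \<union> (\<lambda>c. x + y + c) ` ropts z =
        (\<lambda>a. a + (y + z)) ` ropts x \<union> (\<lambda>p. x + p) ` ropts (y + z)"
    using 1 by (auto simp: ropts_add image_Un image_image optsI cong: image_cong)
  ultimately show ?case by (subst game_add_unfold[of "x + y" z], subst game_add_unfold[of x "y + z"]) simp
qed

lemma game_add_zero: "x + 0 \<le> (x :: 'i::infinite game) \<and> x \<le> x + 0"
proof (induction x rule: opts_induct)
  case (1 x)
  have "\<not> x \<le> a + 0" if "a \<in> lopts x" for a
    using 1[of a] that lopt_lf[of a x] by (meson optsI order_trans)
  moreover have "\<not> b + 0 \<le> x" if "b \<in> ropts x" for b
    using 1[of b] that ropt_lf[of b x] by (meson optsI order_trans)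
  moreover have "\<not> x + 0 \<le> a" if "a \<in> lopts x" for a
  proof -
    have "a + 0 \<in> lopts (x + 0)" using that by (simp add: lopts_add)
    then show ?thesis using 1[of a] that lopt_lf by (meson optsI order_trans)
  qed
  moreover have "\<not> b \<le> x + 0" if "b \<in> ropts x" for b
  proof -
    have "b + 0 \<in> ropts (x + 0)" using that by (simp add: ropts_add)
    then show ?thesis using 1[of b] that ropt_lf by (meson optsI order_trans)
  qed
  ultimately show ?case
    unfolding game_le_iff[of "x + 0" x] game_le_iff[of x "x + 0"] by (auto simp: lopts_add ropts_add)
qed

lemma game_add_le_aux1:
  fixes x y z :: "'i::infinite game"
  assumes "\<And>a. a \<in> opts x \<Longrightarrow> y \<le> z \<longleftrightarrow> a + y \<le> a + z"
    and "\<And>b. b \<in> opts y \<Longrightarrow> z \<le> b \<longleftrightarrow> x + z \<le> x + b"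
    and "\<And>c. c \<in> opts z \<Longrightarrow> c \<le> y \<longleftrightarrow> x + c \<le> x + y"
  shows "y \<le> z \<longleftrightarrow> x + y \<le> x + z"
proof -
  have iff: "x + y \<le> x + z \<longleftrightarrow> (\<forall>a\<in>lopts x. \<not> x + z \<le> a + y) \<and> (\<forall>b\<in>lopts y. \<not> x + z \<le> x + b)
     \<and> (\<forall>a\<in>ropts x. \<not> a + z \<le> x + y) \<and> (\<forall>c\<in>ropts z. \<not> x + c \<le> x + y)"
    by (subst game_le_iff) (auto simp: lopts_add ropts_add)
  have le_iff: "y \<le> z \<longleftrightarrow> (\<forall>b\<in>lopts y. \<not> x + z \<le> x + b) \<and> (\<forall>c\<in>ropts z. \<not> x + c \<le> x + y)"
    by (subst game_le_iff) (use assms(2,3) in \<open>auto simp: optsI\<close>)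
  have "\<not> x + z \<le> a + y" if "y \<le> z" and a: "a \<in> lopts x" for a
  proof
    assume "x + z \<le> a + y"
    also have "a + y \<le> a + z" using assms(1)[of a] that by (simp add: optsI)
    finally show False using lopt_lf[of "a + z" "x + z"] a by (simp add: lopts_add)
  qed
  moreover have "\<not> a + z \<le> x + y" if "y \<le> z" and a: "a \<in> ropts x" for a
  proof
    have "a + y \<le> a + z" using assms(1)[of a] that by (simp add: optsI)
    also assume "a + z \<le> x + y"
    finally show False using ropt_lf[of "a + y" "x + y"] a by (simp add: ropts_add)
  qed
  ultimately show ?thesis using iff le_iff by blast
qed

lemma game_add_le_cancel: "x + y \<le> x + z \<longleftrightarrow> y \<le> (z :: 'i::infinite game)"
proof -
  have "(y \<le> z \<longleftrightarrow> x + y \<le> x + z) \<and> (z \<le> y \<longleftrightarrow> x + z \<le> x + y)"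
  proof (induction x y z rule: game_triple_induct)
    case (1 x y z)
    have "y \<le> z \<longleftrightarrow> x + y \<le> x + z"
      by (rule game_add_le_aux1) (use 1(1) in blast, use 1(2) in blast, use 1(3) in blast)
    moreover have "z \<le> y \<longleftrightarrow> x + z \<le> x + y"
      by (rule game_add_le_aux1) (use 1(1) in blast, use 1(3) in blast, use 1(2) in blast)
    ultimately show ?case by blast
  qed
  then show ?thesis by blast
qed

lemma game_add_neg: "x + - x \<le> (0 :: 'i::infinite game) \<and> 0 \<le> x + - x"
proof (induction x rule: opts_induct)
  case (1 x)
  have "\<not> 0 \<le> a + - x" if "a \<in> lopts x" for a
  proof -
    have "a + - a \<in> ropts (a + - x)" using that by (simp add: ropts_add ropts_neg)
    moreover have "a + - a \<le> 0" using 1 that by (simp add: optsI)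
    ultimately show ?thesis using ropt_lf order_trans by blast
  qed
  moreover have "\<not> 0 \<le> x + - b" if "b \<in> ropts x" for b
  proof -
    have "b + - b \<in> ropts (x + - b)" using that by (simp add: ropts_add)
    moreover have "b + - b \<le> 0" using 1 that by (simp add: optsI)
    ultimately show ?thesis using ropt_lf order_trans by blast
  qed
  moreover have "\<not> b + - x \<le> 0" if "b \<in> ropts x" for b
  proof -
    have "b + - b \<in> lopts (b + - x)" using that by (simp add: lopts_add lopts_neg)
    moreover have "0 \<le> b + - b" using 1 that by (simp add: optsI)
    ultimately show ?thesis using lopt_lf order_trans by blast
  qed
  moreover have "\<not> x + - a \<le> 0" if "a \<in> lopts x" for a
  proof -
    have "a + - a \<in> lopts (x + - a)" using that by (simp add: lopts_add)
    moreover have "0 \<le> a + - a" using 1 that by (simp add: optsI)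
    ultimately show ?thesis using lopt_lf order_trans by blast
  qed
  ultimately show ?case
    unfolding game_le_iff[of "x + - x" 0] game_le_iff[of 0 "x + - x"]
    by (auto simp: lopts_add ropts_add lopts_neg ropts_neg)
qed


subsection \<open>The ordered group of game values\<close>

lemma game_neg_le: "x \<le> y \<Longrightarrow> - y \<le> - (x :: 'i::infinite game)"
proof -
  assume "x \<le> y"
  then have "x + - y \<le> y + - y"
    by (metis game_add_commute game_add_le_cancel)
  also have "\<dots> \<le> 0" by (simp add: game_add_neg)
  also have "0 \<le> x + - x" by (simp add: game_add_neg)
  finally show ?thesis by (simp add: game_add_le_cancel)
qed

instantiation game :: (type) minus
begin
definition minus_game :: "'a game \<Rightarrow> 'a game \<Rightarrow> 'a game" where "x - y = x + - (y :: 'a game)"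
instance ..
end

definition game_eq :: "'i game \<Rightarrow> 'i game \<Rightarrow> bool" where
  "game_eq x y \<longleftrightarrow> x \<le> y \<and> y \<le> x"

lemma equivp_game_eq: "equivp game_eq"
  by (rule equivpI) (auto simp: reflp_def symp_def transp_def game_eq_def intro: order_trans)

quotient_type (overloaded) 'i gval = "'i::infinite game" / game_eq
  by (rule equivp_game_eq)

lemma game_add_mono: "x \<le> x' \<Longrightarrow> y \<le> y' \<Longrightarrow> x + y \<le> x' + (y' :: 'i::infinite game)"
  by (metis game_add_commute game_add_le_cancel order_trans)

instantiation gval :: (infinite) ordered_ab_group_add
begin

lift_definition zero_gval :: "'a gval" is 0 .
lift_definition plus_gval :: "'a gval \<Rightarrow> 'a gval \<Rightarrow> 'a gval" is "(+)"
  by (simp add: game_eq_def game_add_mono)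
lift_definition uminus_gval :: "'a gval \<Rightarrow> 'a gval" is uminus
  by (simp add: game_eq_def game_neg_le)
lift_definition minus_gval :: "'a gval \<Rightarrow> 'a gval \<Rightarrow> 'a gval" is "(-)"
  by (simp add: game_eq_def game_neg_le game_add_mono minus_game_def)
lift_definition less_eq_gval :: "'a gval \<Rightarrow> 'a gval \<Rightarrow> bool" is "(\<le>)"
  by (auto simp: game_eq_def intro: order_trans)
lift_definition less_gval :: "'a gval \<Rightarrow> 'a gval \<Rightarrow> bool" is "(<)"
  by (auto simp: game_eq_def less_game_def intro: order_trans)

instance
proof
  fix a b c :: "'a gval"
  show "a + b + c = a + (b + c)"
    by transfer (simp add: game_eq_def game_add_assoc)
  show "a + b = b + a"
    by transfer (simp add: game_eq_def game_add_commute)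
  show "0 + a = a"
    by transfer (simp add: game_eq_def game_add_commute[of 0] game_add_zero)
  show "- a + a = 0"
    by transfer (simp add: game_eq_def game_add_commute[of "- _"] game_add_neg)
  show "a - b = a + - b"
    by transfer (simp add: game_eq_def minus_game_def)
  show "a < b \<longleftrightarrow> a \<le> b \<and> \<not> b \<le> a"
    by transfer (simp add: less_game_def)
  show "a \<le> a" by transfer simp
  show "a \<le> b \<Longrightarrow> b \<le> c \<Longrightarrow> a \<le> c" by transfer (rule order_trans)
  show "a \<le> b \<Longrightarrow> b \<le> a \<Longrightarrow> a = b" by transfer (simp add: game_eq_def)
  show "a \<le> b \<Longrightarrow> c + a \<le> c + b" by transfer (simp add: game_add_le_cancel)
qed

end

abbreviation val :: "'i::infinite game \<Rightarrow> 'i gval" where "val \<equiv> abs_gval"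

lemma val_simps [simp]:
  "val (x + y) = val x + val y" "val (- x) = - val x" "val (x - y) = val x - val y" "val 0 = 0"
  by (transfer, simp add: game_eq_def)+

lemma val_le_iff [simp]: "val x \<le> val y \<longleftrightarrow> x \<le> y"
  and val_less_iff [simp]: "val x < val y \<longleftrightarrow> x < y"
  by (transfer, simp)+

lemma val_eq_iff: "val x = val y \<longleftrightarrow> x \<le> y \<and> y \<le> x"
  by transfer (simp add: game_eq_def)

lemma game_order_cancel [simp]:
  fixes x y z :: "'i::infinite game"
  shows "x + y < x + z \<longleftrightarrow> y < z" "y + x < z + x \<longleftrightarrow> y < z" "- x < - y \<longleftrightarrow> y < x"
    "x + y \<le> x + z \<longleftrightarrow> y \<le> z" "y + x \<le> z + x \<longleftrightarrow> y \<le> z" "- x \<le> - y \<longleftrightarrow> y \<le> x"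
  by (simp_all flip: val_less_iff val_le_iff)

lemma val_le_iff_opts:
  "val x \<le> val y \<longleftrightarrow> (\<forall>a\<in>lopts x. \<not> val y \<le> val a) \<and> (\<forall>b\<in>ropts y. \<not> val b \<le> val x)"
  unfolding val_le_iff by (rule game_le_iff)

lemma val_leI:
  assumes "val ` lopts x \<subseteq> val ` lopts y" "val ` ropts y \<subseteq> val ` ropts x"
  shows "val x \<le> val y"
  unfolding val_le_iff_opts[of x y]
proof (intro conjI ballI)
  fix a assume "a \<in> lopts x"
  then obtain a' where "a' \<in> lopts y" "val a = val a'" using assms(1) by blast
  then show "\<not> val y \<le> val a" using lopt_lf[of a' y] by simp
next
  fix b assume "b \<in> ropts y"
  then obtain b' where "b' \<in> ropts x" "val b = val b'" using assms(2) by blast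
  then show "\<not> val b \<le> val x" using ropt_lf[of b' x] by simp
qed

lemma val_eqI:
  assumes "val ` lopts x = val ` lopts y" "val ` ropts x = val ` ropts y"
  shows "val x = val y"
  by (rule order_antisym; rule val_leI) (simp_all add: assms)

lemma numeric_zero [simp]: "numeric 0"
  by (rule numeric.intros) (auto simp: opts_def)

lemma numeric_one [simp]: "numeric 1"
  by (rule numeric.intros) (auto simp: opts_def)

lemma numericI_less:
  assumes "\<And>a. a \<in> lopts x \<Longrightarrow> numeric a" "\<And>a. a \<in> ropts x \<Longrightarrow> numeric a"
    and "\<And>a b. a \<in> lopts x \<Longrightarrow> b \<in> ropts x \<Longrightarrow> a < b"
  shows "numeric x"
  by (rule numeric.intros) (use assms in \<open>auto simp: opts_def less_game_def\<close>)

lemma numeric_add: "numeric x \<Longrightarrow> numeric y \<Longrightarrow> numeric (x + y :: 'i::infinite game)"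
proof (induction x y rule: game_pair_induct)
  case (1 x y)
  have l: "l < x + y" if "l \<in> lopts (x + y)" for l
    using that numeric_lopt_less 1(3,4) by (auto simp: lopts_add)
  have r: "x + y < r" if "r \<in> ropts (x + y)" for r
    using that numeric_ropt_less 1(3,4) by (auto simp: ropts_add)
  show ?case
  proof (rule numericI_less)
    show "l < r" if "l \<in> lopts (x + y)" "r \<in> ropts (x + y)" for l r
      using l r that less_trans by blast
  qed (auto simp: lopts_add ropts_add intro!: 1(1) 1(2) intro: optsI numeric_lopts numeric_ropts 1(3) 1(4))
qed

lemma numeric_neg: "numeric x \<Longrightarrow> numeric (- x :: 'i::infinite game)"
proof (induction x rule: opts_induct)
  case (1 x)
  have *: "a < b" if "a \<in> lopts x" "b \<in> ropts x" for a b
    using that 1(2) numeric_lopt_less numeric_ropt_less less_trans by blast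
  have **: "numeric (- a)" if "a \<in> opts x" for a
    using 1 that numeric_opts by blast
  show ?case
    by (rule numericI_less) (auto simp: lopts_neg ropts_neg optsI * **)
qed

lemma numeric_minus: "numeric x \<Longrightarrow> numeric y \<Longrightarrow> numeric (x - y :: 'i::infinite game)"
  by (simp add: minus_game_def numeric_add numeric_neg)


subsection \<open>Multiplication\<close>

lemma mult_opts: "(\<And>k. k \<in># K \<Longrightarrow> k \<in> opts x) \<Longrightarrow> (K + M, {#x#} + M) \<in> mult option_rel"
  by (subst (1 2) add.commute) (rule one_step_implies_mult, auto simp: option_rel_def)

lemma mult_trans: "(A, B) \<in> mult r \<Longrightarrow> (B, C) \<in> mult r \<Longrightarrow> (A, C) \<in> mult r"
  unfolding mult_def by (rule trancl_trans)

lemma mult_pair: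
  assumes "a \<in> opts x"
  shows "({#a, y#}, {#x, y#}) \<in> mult option_rel" "({#y, a#}, {#y, x#}) \<in> mult option_rel"
  using mult_opts[of "{#a#}" x "{#y#}"] assms by (simp_all add: add_mset_commute)

lemma mult_pair2:
  assumes "a \<in> opts x" "b \<in> opts y"
  shows "({#a, b#}, {#x, y#}) \<in> mult option_rel"
  using mult_pair(1)[OF assms(1)] mult_pair(2)[OF assms(2)] by (rule mult_trans[rotated])

function game_mul :: "'i game \<Rightarrow> 'i game \<Rightarrow> 'i game" where
  "game_mul x y =
     mk_game ((\<lambda>(a, b). game_mul a y + game_mul x b - game_mul a b) ` (lopts x \<times> lopts y \<union> ropts x \<times> ropts y))
             ((\<lambda>(a, b). game_mul a y + game_mul x b - game_mul a b) ` (lopts x \<times> ropts y \<union> ropts x \<times> lopts y))"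
  by auto
termination
proof (relation "inv_image (mult option_rel) (\<lambda>(x, y). {#x, y#})", goal_cases)
  case 1 show ?case by (intro wf_inv_image wf_mult wf_option_rel)
qed (auto simp: opts_def intro!: mult_pair mult_pair2)

declare game_mul.simps [simp del]

instantiation game :: (type) times
begin
definition times_game :: "'a game \<Rightarrow> 'a game \<Rightarrow> 'a game" where "times_game = game_mul"
instance ..
end

lemma game_mul_unfold:
  "x * y =
     mk_game ((\<lambda>(a, b). a * y + x * b - a * b) ` (lopts x \<times> lopts y \<union> ropts x \<times> ropts y))
             ((\<lambda>(a, b). a * y + x * b - a * b) ` (lopts x \<times> ropts y \<union> ropts x \<times> lopts y))"
  unfolding times_game_def by (subst game_mul.simps) simp

lemma lopts_mul: "lopts (x * y :: 'i::infinite game) =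
    (\<lambda>(a, b). a * y + x * b - a * b) ` (lopts x \<times> lopts y \<union> ropts x \<times> ropts y)"
  and ropts_mul: "ropts (x * y :: 'i::infinite game) =
    (\<lambda>(a, b). a * y + x * b - a * b) ` (lopts x \<times> ropts y \<union> ropts x \<times> lopts y)"
  by (subst game_mul_unfold; simp)+

lemma val_image_lopts_mul: "val ` lopts (x * y :: 'i::infinite game) =
    (\<lambda>(a, b). val (a * y) + val (x * b) - val (a * b)) ` (lopts x \<times> lopts y \<union> ropts x \<times> ropts y)"
  and val_image_ropts_mul: "val ` ropts (x * y :: 'i::infinite game) =
    (\<lambda>(a, b). val (a * y) + val (x * b) - val (a * b)) ` (lopts x \<times> ropts y \<union> ropts x \<times> lopts y)"
  unfolding lopts_mul ropts_mul image_image by (auto intro!: image_cong)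

lemma game_pair_induct_strong:
  assumes "\<And>x y :: 'i game. (\<And>a y'. a \<in> opts x \<Longrightarrow> P a y') \<Longrightarrow> (\<And>b. b \<in> opts y \<Longrightarrow> P x b) \<Longrightarrow> P x y"
  shows "P x y"
proof (induction x arbitrary: y rule: opts_induct)
  case (1 x y) note IHx = this
  show ?case
  proof (induction y rule: opts_induct)
    case (1 y) show ?case by (rule assms) (simp_all add: IHx 1)
  qed
qed

lemma game_triple_induct_strong:
  assumes "\<And>x y z :: 'i game. (\<And>a y' z'. a \<in> opts x \<Longrightarrow> P a y' z') \<Longrightarrow>
      (\<And>b z'. b \<in> opts y \<Longrightarrow> P x b z') \<Longrightarrow> (\<And>c. c \<in> opts z \<Longrightarrow> P x y c) \<Longrightarrow> P x y z"
  shows "P x y z"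
proof (induction x arbitrary: y z rule: opts_induct)
  case (1 x y z) note IHx = this
  show ?case
  proof (induction y arbitrary: z rule: opts_induct)
    case (1 y z) note IHy = this
    show ?case
    proof (induction z rule: opts_induct)
      case (1 z) show ?case by (rule assms) (simp_all add: IHx IHy 1)
    qed
  qed
qed

lemma bex_opts_simps:
  fixes x y :: "'i::infinite game"
  shows "(\<exists>p\<in>lopts (x * y). P p) \<longleftrightarrow>
      (\<exists>a\<in>lopts x. \<exists>b\<in>lopts y. P (a * y + x * b - a * b)) \<or>
      (\<exists>a\<in>ropts x. \<exists>b\<in>ropts y. P (a * y + x * b - a * b))"
    and "(\<exists>p\<in>ropts (x * y). P p) \<longleftrightarrow>
      (\<exists>a\<in>lopts x. \<exists>b\<in>ropts y. P (a * y + x * b - a * b)) \<or>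
      (\<exists>a\<in>ropts x. \<exists>b\<in>lopts y. P (a * y + x * b - a * b))"
    and "(\<exists>p\<in>lopts (x + y). P p) \<longleftrightarrow> (\<exists>a\<in>lopts x. P (a + y)) \<or> (\<exists>b\<in>lopts y. P (x + b))"
    and "(\<exists>p\<in>ropts (x + y). P p) \<longleftrightarrow> (\<exists>a\<in>ropts x. P (a + y)) \<or> (\<exists>b\<in>ropts y. P (x + b))"
    and "(\<exists>p\<in>lopts (- x). P p) \<longleftrightarrow> (\<exists>a\<in>ropts x. P (- a))"
    and "(\<exists>p\<in>ropts (- x). P p) \<longleftrightarrow> (\<exists>a\<in>lopts x. P (- a))"
  by (simp_all add: lopts_mul ropts_mul lopts_add ropts_add lopts_neg ropts_neg bex_Un)

lemma game_mul_commute: "x * y = y * (x :: 'i game)"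
proof (induction x y rule: game_pair_induct_strong)
  case (1 x y)
  have eq: "a * y + x * b - a * b = b * x + y * a - b * a" if "a \<in> opts x" "b \<in> opts y" for a b
    using 1(1)[OF that(1), of y] 1(1)[OF that(1), of b] 1(2)[OF that(2)]
    by (simp add: game_add_commute)
  have swap: "(\<lambda>(a, b). a * y + x * b - a * b) ` (A \<times> B \<union> C \<times> D) =
              (\<lambda>(b, a). b * x + y * a - b * a) ` (B \<times> A \<union> D \<times> C)"
    if "A \<subseteq> opts x" "C \<subseteq> opts x" "B \<subseteq> opts y" "D \<subseteq> opts y" for A B C D
  proof -
    have "(\<lambda>(a, b). a * y + x * b - a * b) ` (A \<times> B \<union> C \<times> D) =
          (\<lambda>(a, b). b * x + y * a - b * a) ` (A \<times> B \<union> C \<times> D)"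
      using that eq by (intro image_cong refl) (auto simp: subset_iff)
    also have "\<dots> = (\<lambda>(b, a). b * x + y * a - b * a) ` (\<lambda>(a, b). (b, a)) ` (A \<times> B \<union> C \<times> D)"
      by (simp add: image_image case_prod_unfold)
    also have "(\<lambda>(a, b). (b, a)) ` (A \<times> B \<union> C \<times> D) = B \<times> A \<union> D \<times> C"
      by (simp add: image_Un swap_product)
    finally show ?thesis .
  qed
  show ?case
    unfolding game_mul_unfold[of x y] game_mul_unfold[of y x]
    by (subst (1 2) swap) (auto simp: opts_def Un_commute)
qed

lemma val_mul_zero [simp]: "val (x * 0) = 0" "val (0 * x) = 0"
proof -
  show "val (x * 0) = 0"
    unfolding val_simps(4)[symmetric] by (rule val_eqI) (simp_all add: lopts_mul ropts_mul)
  show "val (0 * x) = 0"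
    unfolding val_simps(4)[symmetric] by (rule val_eqI) (simp_all add: lopts_mul ropts_mul)
qed

lemma val_mul_one [simp]: "val (x * 1) = val x"
proof (induction x rule: opts_induct)
  case (1 x)
  show ?case
    by (rule val_eqI; rule set_eqI)
       (simp_all add: image_iff bex_opts_simps 1 optsI cong: bex_cong)
qed

lemma val_mul_neg_left: "val (- x * y) = - val (x * y)"
proof (induction x y rule: game_pair_induct_strong)
  case (1 x y)
  have "val (- x * y) = val (- (x * y))"
    by (rule val_eqI; rule set_eqI)
       (simp_all add: image_iff bex_opts_simps 1 optsI disj_commute algebra_simps cong: bex_cong)
  then show ?case by simp
qed

lemma val_mul_add_left: "val ((x + y) * z) = val (x * z) + val (y * z)"
proof (induction x y z rule: game_triple_induct_strong)
  case (1 x y z)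
  have "val ((x + y) * z) = val (x * z + y * z)"
    by (rule val_eqI; rule set_eqI)
       (simp_all add: image_iff bex_opts_simps bex_disj_distrib 1 optsI algebra_simps cong: bex_cong, blast+)
  then show ?case by simp
qed

lemma val_mul_distrib:
  "val ((x + y) * z) = val (x * z) + val (y * z)"
  "val ((x - y) * z) = val (x * z) - val (y * z)"
  "val (- x * z) = - val (x * z)"
  "val (z * (x + y)) = val (z * x) + val (z * y)"
  "val (z * (x - y)) = val (z * x) - val (z * y)"
  "val (z * - x) = - val (z * x)"
  by (simp_all add: val_mul_add_left val_mul_neg_left minus_game_def game_mul_commute[of z])

lemma val_mul_assoc: "val ((x * y) * z) = val (x * (y * z))"
proof (induction x y z rule: game_triple_induct_strong)
  case (1 x y z)
  show ?case
    by (rule val_eqI; rule set_eqI)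
       (simp_all add: image_iff bex_opts_simps bex_disj_distrib val_mul_distrib 1 optsI algebra_simps
         cong: bex_cong, blast+)
qed

text \<open>
  Products of numbers are numbers, and equality of numbers is a congruence for the product. Both
  are proved by one induction on the multiset of the games involved; \<open>rect\<close> is the value of
  \<open>(x2 - x1) * (y2 - y1)\<close>.
\<close>

definition rect :: "'i::infinite game \<Rightarrow> 'i game \<Rightarrow> 'i game \<Rightarrow> 'i game \<Rightarrow> 'i gval" where
  "rect x1 x2 y1 y2 = val (x1 * y1) + val (x2 * y2) - val (x1 * y2) - val (x2 * y1)"

lemma rect_swap: "rect x1 x2 y1 y2 = rect y1 y2 x1 x2"
  by (simp add: rect_def game_mul_commute algebra_simps)

lemma rect_flip: "rect x2 x1 y2 y1 = rect x1 x2 y1 y2"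
  by (simp add: rect_def algebra_simps)

definition mul_mono_at :: "'i::infinite game \<Rightarrow> 'i game \<Rightarrow> 'i game \<Rightarrow> bool" where
  "mul_mono_at x1 x2 y \<longleftrightarrow> x1 < x2 \<longrightarrow>
     (\<forall>b\<in>lopts y. 0 < rect x1 x2 b y) \<and> (\<forall>b\<in>ropts y. 0 < rect x1 x2 y b)"

definition mul_cong_at :: "'i::infinite game \<Rightarrow> 'i game \<Rightarrow> 'i game \<Rightarrow> bool" where
  "mul_cong_at x1 x2 y \<longleftrightarrow> val x1 = val x2 \<longrightarrow> val (x1 * y) = val (x2 * y)"

lemma mul_mono_atD:
  assumes "mul_mono_at x1 x2 y" "x1 < x2"
  shows "b \<in> lopts y \<Longrightarrow> 0 < rect x1 x2 b y" "b \<in> ropts y \<Longrightarrow> 0 < rect x1 x2 y b"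
  using assms by (auto simp: mul_mono_at_def)

lemma mul_cong_atD: "mul_cong_at x1 x2 y \<Longrightarrow> val x1 = val x2 \<Longrightarrow> val (x1 * y) = val (x2 * y)"
  by (simp add: mul_cong_at_def)

lemma numeric_cases:
  assumes "numeric x" "numeric (y :: 'i::infinite game)"
  obtains "x < y" | "y < x" | "val x = val y"
  using assms numeric_total[of x y] unfolding val_eq_iff less_game_def by blast

lemma numeric_mul_step_L:
  assumes "numeric x" "numeric (y :: 'i::infinite game)"
    and a: "a \<in> lopts x" "a' \<in> lopts x" and b: "b \<in> lopts y" and c: "c \<in> ropts y"
    and mx: "mul_mono_at a a' y" "mul_mono_at a' a y" and my: "mul_mono_at b c x"
    and cx: "mul_cong_at a a' y" "mul_cong_at a a' c"
  shows "0 < rect a x b y - rect a' x c y"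
proof -
  have "b < c" using assms numeric_lopt_less numeric_ropt_less less_trans by blast
  then have bc: "0 < rect a x b c" "0 < rect a' x b c"
    using mul_mono_atD(1)[OF my] a by (simp_all add: rect_swap[of _ x])
  have "numeric a" "numeric a'" using assms numeric_lopts by blast+
  then show ?thesis
  proof (cases rule: numeric_cases)
    case 1
    have "rect a x b y - rect a' x c y = rect a a' b y + rect a' x b c"
      by (simp add: rect_def algebra_simps)
    also have "0 < \<dots>" by (rule add_pos_pos[OF mul_mono_atD(1)[OF mx(1) 1 b] bc(2)])
    finally show ?thesis .
  next
    case 2
    have "rect a x b y - rect a' x c y = rect a x b c + rect a' a y c"
      by (simp add: rect_def algebra_simps)
    also have "0 < \<dots>" by (rule add_pos_pos[OF bc(1) mul_mono_atD(2)[OF mx(2) 2 c]])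
    finally show ?thesis .
  next
    case 3
    have "rect a x b y - rect a' x c y = rect a x b c"
      using mul_cong_atD[OF cx(1) 3] mul_cong_atD[OF cx(2) 3] by (simp add: rect_def algebra_simps)
    then show ?thesis using bc by simp
  qed
qed

lemma numeric_mul_step_R:
  assumes "numeric x" "numeric (y :: 'i::infinite game)"
    and a: "a \<in> ropts x" "a' \<in> ropts x" and b: "b \<in> ropts y" and c: "c \<in> lopts y"
    and mx: "mul_mono_at a a' y" "mul_mono_at a' a y" and my: "mul_mono_at c b x"
    and cx: "mul_cong_at a a' y" "mul_cong_at a a' c"
  shows "0 < rect a x b y - rect a' x c y"
proof -
  have "c < b" using assms numeric_lopt_less numeric_ropt_less less_trans by blast
  moreover have "rect a x b c = rect c b x a" for a
    by (subst rect_swap, subst rect_flip) simp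
  ultimately have bc: "0 < rect a x b c" "0 < rect a' x b c"
    using mul_mono_atD(2)[OF my] a by simp_all
  have "numeric a" "numeric a'" using assms numeric_ropts by blast+
  then show ?thesis
  proof (cases rule: numeric_cases)
    case 1
    have "rect a x b y - rect a' x c y = rect a x b c + rect a a' c y"
      by (simp add: rect_def algebra_simps)
    also have "0 < \<dots>" by (rule add_pos_pos[OF bc(1) mul_mono_atD(1)[OF mx(1) 1 c]])
    finally show ?thesis .
  next
    case 2
    have "rect a x b y - rect a' x c y = rect a' a y b + rect a' x b c"
      by (simp add: rect_def algebra_simps)
    also have "0 < \<dots>" by (rule add_pos_pos[OF mul_mono_atD(2)[OF mx(2) 2 b] bc(2)])
    finally show ?thesis .
  next
    case 3
    have "rect a x b y - rect a' x c y = rect a x b c"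
      using mul_cong_atD[OF cx(1) 3] mul_cong_atD[OF cx(2) 3] by (simp add: rect_def algebra_simps)
    then show ?thesis using bc by simp
  qed
qed

lemma val_mul_opt_diff:
  "val (a * y + x * b - a * b) = val (x * y) - rect a x b y"
  "val (a * y + x * b - a * b) = val (x * y) + rect a x y b"
  by (simp_all add: rect_def algebra_simps)

lemma numeric_mul_step:
  assumes x: "numeric x" and y: "numeric (y :: 'i::infinite game)"
    and num: "\<And>a. a \<in> opts x \<Longrightarrow> numeric (a * y)" "\<And>b. b \<in> opts y \<Longrightarrow> numeric (x * b)"
      "\<And>a b. a \<in> opts x \<Longrightarrow> b \<in> opts y \<Longrightarrow> numeric (a * b)"
    and mono: "\<And>a a'. a \<in> opts x \<Longrightarrow> a' \<in> opts x \<Longrightarrow> mul_mono_at a a' y"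
      "\<And>b b'. b \<in> opts y \<Longrightarrow> b' \<in> opts y \<Longrightarrow> mul_mono_at b b' x"
    and cong: "\<And>a a'. a \<in> opts x \<Longrightarrow> a' \<in> opts x \<Longrightarrow> mul_cong_at a a' y"
      "\<And>b b'. b \<in> opts y \<Longrightarrow> b' \<in> opts y \<Longrightarrow> mul_cong_at b b' x"
      "\<And>a a' b. a \<in> opts x \<Longrightarrow> a' \<in> opts x \<Longrightarrow> b \<in> opts y \<Longrightarrow> mul_cong_at a a' b"
      "\<And>b b' a. b \<in> opts y \<Longrightarrow> b' \<in> opts y \<Longrightarrow> a \<in> opts x \<Longrightarrow> mul_cong_at b b' a"
  shows "numeric (x * y)"
proof (rule numericI_less)
  have num': "numeric (a * y + x * b - a * b)" if "a \<in> opts x" "b \<in> opts y" for a b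
    using that num by (intro numeric_minus numeric_add) auto
  show "numeric p" if "p \<in> lopts (x * y)" for p
    using that num' by (auto simp: lopts_mul optsI)
  show "numeric p" if "p \<in> ropts (x * y)" for p
    using that num' by (auto simp: ropts_mul optsI)
  have diff: "a * y + x * b - a * b < a' * y + x * b' - a' * b'"
    if "0 < rect a x b y - rect a' x b' y" for a b a' b'
  proof -
    have "val (a * y + x * b - a * b) < val (a' * y + x * b' - a' * b')"
      using that unfolding val_mul_opt_diff(1)[of _ y x] by (simp add: algebra_simps)
    then show ?thesis by (simp only: val_less_iff)
  qed
  fix p q assume "p \<in> lopts (x * y)" "q \<in> ropts (x * y)"
  then obtain a b a' b' where p: "p = a * y + x * b - a * b" and q: "q = a' * y + x * b' - a' * b'"
    and ab: "a \<in> lopts x \<and> b \<in> lopts y \<or> a \<in> ropts x \<and> b \<in> ropts y"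
    and ab': "a' \<in> lopts x \<and> b' \<in> ropts y \<or> a' \<in> ropts x \<and> b' \<in> lopts y"
    by (auto simp: lopts_mul ropts_mul)
  have "0 < rect a x b y - rect a' x b' y"
    using ab ab'
  proof (elim disjE conjE)
    assume "a \<in> lopts x" "b \<in> lopts y" "a' \<in> lopts x" "b' \<in> ropts y"
    then show ?thesis by (intro numeric_mul_step_L) (simp_all add: x y mono cong optsI)
  next
    assume "a \<in> ropts x" "b \<in> ropts y" "a' \<in> ropts x" "b' \<in> lopts y"
    then show ?thesis by (intro numeric_mul_step_R) (simp_all add: x y mono cong optsI)
  next
    assume "a \<in> lopts x" "b \<in> lopts y" "a' \<in> ropts x" "b' \<in> lopts y"
    then have "0 < rect b y a x - rect b' y a' x"
      by (intro numeric_mul_step_L) (simp_all add: x y mono cong optsI)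
    then show ?thesis by (simp only: rect_swap[of b] rect_swap[of b'])
  next
    assume "a \<in> ropts x" "b \<in> ropts y" "a' \<in> lopts x" "b' \<in> ropts y"
    then have "0 < rect b y a x - rect b' y a' x"
      by (intro numeric_mul_step_R) (simp_all add: x y mono cong optsI)
    then show ?thesis by (simp only: rect_swap[of b] rect_swap[of b'])
  qed
  then show "p < q" unfolding p q by (rule diff)
qed

lemma numeric_mul_rect:
  assumes "numeric (x * y :: 'i::infinite game)"
  shows "a \<in> lopts x \<Longrightarrow> b \<in> lopts y \<Longrightarrow> 0 < rect a x b y"
    and "a \<in> ropts x \<Longrightarrow> b \<in> ropts y \<Longrightarrow> 0 < rect a x b y"
    and "a \<in> lopts x \<Longrightarrow> b \<in> ropts y \<Longrightarrow> 0 < rect a x y b"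
    and "a \<in> ropts x \<Longrightarrow> b \<in> lopts y \<Longrightarrow> 0 < rect a x y b"
proof -
  have l: "0 < rect a x b y" if "(a, b) \<in> lopts x \<times> lopts y \<union> ropts x \<times> ropts y"
  proof -
    have "a * y + x * b - a * b \<in> lopts (x * y)"
      unfolding lopts_mul using that by (rule rev_image_eqI) simp
    then have "val (a * y + x * b - a * b) < val (x * y)"
      using numeric_lopt_less[OF assms] by (simp only: val_less_iff)
    then show ?thesis unfolding val_mul_opt_diff(1)[of a y x] by simp
  qed
  have r: "0 < rect a x y b" if "(a, b) \<in> lopts x \<times> ropts y \<union> ropts x \<times> lopts y"
  proof -
    have "a * y + x * b - a * b \<in> ropts (x * y)"
      unfolding ropts_mul using that by (rule rev_image_eqI) simp
    then have "val (x * y) < val (a * y + x * b - a * b)"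
      using numeric_ropt_less[OF assms] by (simp only: val_less_iff)
    then show ?thesis unfolding val_mul_opt_diff(2)[of a y x] by simp
  qed
  show "a \<in> lopts x \<Longrightarrow> b \<in> lopts y \<Longrightarrow> 0 < rect a x b y"
    "a \<in> ropts x \<Longrightarrow> b \<in> ropts y \<Longrightarrow> 0 < rect a x b y"
    "a \<in> lopts x \<Longrightarrow> b \<in> ropts y \<Longrightarrow> 0 < rect a x y b"
    "a \<in> ropts x \<Longrightarrow> b \<in> lopts y \<Longrightarrow> 0 < rect a x y b"
    using l r by blast+
qed

lemma mul_cong_le_step:
  assumes x: "numeric x1" "numeric x2" and y: "numeric (y :: 'i::infinite game)"
    and eq: "val x1 = val x2"
    and mono: "\<And>a. a \<in> opts x1 \<Longrightarrow> mul_mono_at a x2 y \<and> mul_mono_at x2 a y"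
      "\<And>a. a \<in> opts x2 \<Longrightarrow> mul_mono_at a x1 y \<and> mul_mono_at x1 a y"
    and cong: "\<And>b. b \<in> opts y \<Longrightarrow> mul_cong_at x1 x2 b"
  shows "x1 * y \<le> x2 * y"
proof -
  have eqb: "val (x1 * b) = val (x2 * b)" if "b \<in> opts y" for b
    using mul_cong_atD[OF cong[OF that] eq] .
  have lt1: "a < x2" if "a \<in> lopts x1" for a
    using numeric_lopt_less[OF x(1) that] eq by (metis val_less_iff)
  have lt2: "x2 < a" if "a \<in> ropts x1" for a
    using numeric_ropt_less[OF x(1) that] eq by (metis val_less_iff)
  have lt3: "a < x1" if "a \<in> lopts x2" for a
    using numeric_lopt_less[OF x(2) that] eq by (metis val_less_iff)
  have lt4: "x1 < a" if "a \<in> ropts x2" for a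
    using numeric_ropt_less[OF x(2) that] eq by (metis val_less_iff)
  have l: "p < x2 * y" if "p \<in> lopts (x1 * y)" for p
  proof -
    obtain a b where p: "p = a * y + x1 * b - a * b"
      and ab: "a \<in> lopts x1 \<and> b \<in> lopts y \<or> a \<in> ropts x1 \<and> b \<in> ropts y"
      using \<open>p \<in> lopts (x1 * y)\<close> by (auto simp: lopts_mul)
    have "0 < rect a x2 b y"
      using ab
    proof (elim disjE conjE)
      assume "a \<in> lopts x1" "b \<in> lopts y"
      then show ?thesis using mono(1)[of a] lt1 by (auto simp: optsI intro: mul_mono_atD)
    next
      assume "a \<in> ropts x1" "b \<in> ropts y"
      then have "0 < rect x2 a y b" using mono(1)[of a] lt2 by (auto simp: optsI intro: mul_mono_atD)
      then show ?thesis by (subst rect_flip) simp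
    qed
    moreover have "val p = val (x2 * y) - rect a x2 b y"
      using eqb[of b] ab unfolding p by (auto simp: optsI rect_def algebra_simps)
    ultimately have "val p < val (x2 * y)" by simp
    then show ?thesis by simp
  qed
  have r: "x1 * y < p" if "p \<in> ropts (x2 * y)" for p
  proof -
    obtain a b where p: "p = a * y + x2 * b - a * b"
      and ab: "a \<in> lopts x2 \<and> b \<in> ropts y \<or> a \<in> ropts x2 \<and> b \<in> lopts y"
      using \<open>p \<in> ropts (x2 * y)\<close> by (auto simp: ropts_mul)
    have "0 < rect a x1 y b"
      using ab
    proof (elim disjE conjE)
      assume "a \<in> lopts x2" "b \<in> ropts y"
      then show ?thesis using mono(2)[of a] lt3 by (auto simp: optsI intro: mul_mono_atD)
    next
      assume "a \<in> ropts x2" "b \<in> lopts y"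
      then have "0 < rect x1 a b y" using mono(2)[of a] lt4 by (auto simp: optsI intro: mul_mono_atD)
      then show ?thesis by (subst rect_flip) simp
    qed
    moreover have "val p = val (x1 * y) + rect a x1 y b"
      using eqb[of b] ab unfolding p by (auto simp: optsI rect_def algebra_simps)
    ultimately have "val (x1 * y) < val p" by simp
    then show ?thesis by simp
  qed
  show ?thesis
    unfolding game_le_iff[of "x1 * y" "x2 * y"] using l r by (auto simp: less_game_def)
qed

lemma rect_trans: "rect x1 x2 y y' + rect x2 x3 y y' = rect x1 x3 y y'"
  by (simp add: rect_def)

lemma mul_mono_step:
  assumes x: "numeric x1" "numeric x2" and y: "numeric (y :: 'i::infinite game)"
    and num: "numeric (x1 * y)" "numeric (x2 * y)"
    and mono: "\<And>a. a \<in> opts x1 \<Longrightarrow> mul_mono_at a x2 y"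
      "\<And>a. a \<in> opts x2 \<Longrightarrow> mul_mono_at x1 a y"
    and cong: "\<And>a. a \<in> opts x1 \<Longrightarrow> mul_cong_at a x2 y"
      "\<And>a. a \<in> opts x2 \<Longrightarrow> mul_cong_at x1 a y"
      "\<And>a b. a \<in> opts x1 \<Longrightarrow> b \<in> opts y \<Longrightarrow> mul_cong_at a x2 b"
      "\<And>a b. a \<in> opts x2 \<Longrightarrow> b \<in> opts y \<Longrightarrow> mul_cong_at x1 a b"
  shows "mul_mono_at x1 x2 y"
  unfolding mul_mono_at_def
proof
  assume "x1 < x2"
  then have "\<not> x2 \<le> x1" by (simp add: less_game_def)
  then consider a where "a \<in> lopts x2" "x1 \<le> a" | a where "a \<in> ropts x1" "a \<le> x2"
    by (auto simp: game_le_iff[of x2 x1])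
  then show "(\<forall>b\<in>lopts y. 0 < rect x1 x2 b y) \<and> (\<forall>b\<in>ropts y. 0 < rect x1 x2 y b)"
  proof cases
    case 1
    have nn: "(\<forall>b\<in>lopts y. 0 \<le> rect x1 a b y) \<and> (\<forall>b\<in>ropts y. 0 \<le> rect x1 a y b)"
    proof (cases "x1 < a")
      case True
      then show ?thesis using mono(2)[of a] 1 by (auto simp: optsI mul_mono_at_def less_imp_le)
    next
      case False
      then have eq: "val x1 = val a" using 1 by (simp add: val_eq_iff less_game_def)
      have "val (x1 * b) = val (a * b)" if "b \<in> opts y" for b
        using cong(4)[of a b] that 1 eq by (simp add: optsI mul_cong_at_def)
      moreover have "val (x1 * y) = val (a * y)"
        using cong(2)[of a] 1 eq by (simp add: optsI mul_cong_at_def)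
      ultimately show ?thesis by (simp add: rect_def optsI)
    qed
    show ?thesis
      using nn numeric_mul_rect(1,3)[OF num(2) 1(1)]
        rect_trans[of x1 a _ _ x2, symmetric] by (auto intro: add_nonneg_pos)
  next
    case 2
    have nn: "(\<forall>b\<in>lopts y. 0 \<le> rect a x2 b y) \<and> (\<forall>b\<in>ropts y. 0 \<le> rect a x2 y b)"
    proof (cases "a < x2")
      case True
      then show ?thesis using mono(1)[of a] 2 by (auto simp: optsI mul_mono_at_def less_imp_le)
    next
      case False
      then have eq: "val a = val x2" using 2 by (simp add: val_eq_iff less_game_def)
      have "val (a * b) = val (x2 * b)" if "b \<in> opts y" for b
        using cong(3)[of a b] that 2 eq by (simp add: optsI mul_cong_at_def)
      moreover have "val (a * y) = val (x2 * y)"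
        using cong(1)[of a] 2 eq by (simp add: optsI mul_cong_at_def)
      ultimately show ?thesis by (simp add: rect_def optsI)
    qed
    have "\<forall>b\<in>lopts y. 0 < rect x1 a b y" "\<forall>b\<in>ropts y. 0 < rect x1 a y b"
      using numeric_mul_rect(2,4)[OF num(1) 2(1)] rect_flip[of a x1] by auto
    then show ?thesis
      using nn rect_trans[of x1 a _ _ x2, symmetric] by (auto intro: add_pos_nonneg)
  qed
qed

lemma mult_optsI:
  assumes "set_mset K \<subseteq> opts x" "N = {#x#} + M" "N' = K + M"
  shows "(N', N) \<in> mult option_rel"
  unfolding assms(2,3) by (rule mult_opts) (use assms(1) in auto)

lemma mult_triple:
  shows "a \<in> opts x \<Longrightarrow> ({#a, y, z#}, {#x, y, z#}) \<in> mult option_rel"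
    and "a \<in> opts x \<Longrightarrow> ({#y, a, z#}, {#y, x, z#}) \<in> mult option_rel"
    and "a \<in> opts x \<Longrightarrow> ({#y, z, a#}, {#y, z, x#}) \<in> mult option_rel"
    and "({#y, z#}, {#x, y, z#}) \<in> mult option_rel"
    and "({#y, z#}, {#y, x, z#}) \<in> mult option_rel"
    and "a \<in> opts x \<Longrightarrow> a' \<in> opts x \<Longrightarrow> ({#a, a', y#}, {#x, y#}) \<in> mult option_rel"
    and "a \<in> opts x \<Longrightarrow> a' \<in> opts x \<Longrightarrow> ({#a, a', y#}, {#y, x#}) \<in> mult option_rel"
  by (auto intro: mult_optsI[where x = x and K = "{#a#}" and M = "{#y, z#}"]
      mult_optsI[where x = x and K = "{#}" and M = "{#y, z#}"]
      mult_optsI[where x = x and K = "{#a, a'#}" and M = "{#y#}"] simp: add_mset_commute)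

lemma mul_main:
  "(\<forall>x y :: 'i::infinite game. M = {#x, y#} \<longrightarrow> numeric x \<longrightarrow> numeric y \<longrightarrow> numeric (x * y)) \<and>
   (\<forall>x1 x2 y :: 'i game. M = {#x1, x2, y#} \<longrightarrow> numeric x1 \<longrightarrow> numeric x2 \<longrightarrow> numeric y \<longrightarrow>
      mul_cong_at x1 x2 y \<and> mul_mono_at x1 x2 y)"
proof (induction M rule: wf_induct_rule[OF wf_mult[OF wf_option_rel]])
  case (1 M)
  have ih2: "numeric (x * y)" if "({#x, y#}, M) \<in> mult option_rel" "numeric x" "numeric y" for x y :: "'i game"
    using 1[OF that(1)] that by blast
  have ih3: "mul_cong_at x1 x2 y" "mul_mono_at x1 x2 y"
    if "({#x1, x2, y#}, M) \<in> mult option_rel" "numeric x1" "numeric x2" "numeric y" for x1 x2 y :: "'i game"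
    using 1[OF that(1)] that by blast+
  show ?case
  proof (intro conjI allI impI)
    fix x y :: "'i game" assume M: "M = {#x, y#}" and x: "numeric x" and y: "numeric y"
    note nx = numeric_opts[OF x] and ny = numeric_opts[OF y]
    have m1: "({#a, a', y#}, M) \<in> mult option_rel" if "a \<in> opts x" "a' \<in> opts x" for a a'
      unfolding M using that by (rule mult_triple(6))
    have m2: "({#b, b', x#}, M) \<in> mult option_rel" if "b \<in> opts y" "b' \<in> opts y" for b b'
      unfolding M using that by (rule mult_triple(7))
    have m3: "({#a, a', b#}, M) \<in> mult option_rel" if "a \<in> opts x" "a' \<in> opts x" "b \<in> opts y" for a a' b
      using mult_trans[OF mult_triple(3) m1] that by blast
    have m4: "({#b, b', a#}, M) \<in> mult option_rel" if "b \<in> opts y" "b' \<in> opts y" "a \<in> opts x" for b b' a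
      using mult_trans[OF mult_triple(3) m2] that by blast
    have m5: "({#a, y#}, M) \<in> mult option_rel" if "a \<in> opts x" for a
      unfolding M using that by (rule mult_pair)
    have m6: "({#x, b#}, M) \<in> mult option_rel" if "b \<in> opts y" for b
      unfolding M using that by (rule mult_pair)
    have m7: "({#a, b#}, M) \<in> mult option_rel" if "a \<in> opts x" "b \<in> opts y" for a b
      unfolding M using that by (rule mult_pair2)
    show "numeric (x * y)"
      by (rule numeric_mul_step[OF x y])
         (blast intro: ih2 ih3 x y nx ny m1 m2 m3 m4 m5 m6 m7)+
  next
    fix x1 x2 y :: "'i game"
    assume M: "M = {#x1, x2, y#}" and x: "numeric x1" "numeric x2" and y: "numeric y"
    note n1 = numeric_opts[OF x(1)] and n2 = numeric_opts[OF x(2)] and ny = numeric_opts[OF y]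
    have m1: "({#a, x2, y#}, M) \<in> mult option_rel" "({#x2, a, y#}, M) \<in> mult option_rel" if "a \<in> opts x1" for a
      using that mult_triple(1)[of a x1 x2 y] unfolding M by (simp_all add: add_mset_commute)
    have m2: "({#x1, a, y#}, M) \<in> mult option_rel" "({#a, x1, y#}, M) \<in> mult option_rel" if "a \<in> opts x2" for a
      using that mult_triple(2)[of a x2 x1 y] unfolding M by (simp_all add: add_mset_commute)
    have m3: "({#x1, x2, b#}, M) \<in> mult option_rel" "({#x2, x1, b#}, M) \<in> mult option_rel" if "b \<in> opts y" for b
      using that mult_triple(3)[of b y x1 x2] unfolding M by (simp_all add: add_mset_commute)
    have m4: "({#a, x2, b#}, M) \<in> mult option_rel" if "a \<in> opts x1" "b \<in> opts y" for a b
      using mult_trans[OF mult_triple(3) m1(1)] that by blast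
    have m5: "({#x1, a, b#}, M) \<in> mult option_rel" if "a \<in> opts x2" "b \<in> opts y" for a b
      using mult_trans[OF mult_triple(3) m2(1)] that by blast
    have m6: "({#x1, y#}, M) \<in> mult option_rel" "({#x2, y#}, M) \<in> mult option_rel"
      unfolding M by (rule mult_triple(5), rule mult_triple(4))
    show "mul_cong_at x1 x2 y"
      unfolding mul_cong_at_def val_eq_iff[of "x1 * y"]
    proof (intro impI conjI)
      assume eq: "val x1 = val x2"
      show "x1 * y \<le> x2 * y"
        by (rule mul_cong_le_step[OF x y eq]) (blast intro: ih3 x y n1 n2 ny m1 m2 m3)+
      show "x2 * y \<le> x1 * y"
        by (rule mul_cong_le_step[OF x(2,1) y eq[symmetric]]) (blast intro: ih3 x y n1 n2 ny m1 m2 m3)+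
    qed
    show "mul_mono_at x1 x2 y"
      by (rule mul_mono_step[OF x y]) (blast intro: ih2 ih3 x y n1 n2 ny m1 m2 m4 m5 m6)+
  qed
qed

lemma numeric_mul: "numeric x \<Longrightarrow> numeric y \<Longrightarrow> numeric (x * y :: 'i::infinite game)"
  using mul_main[of "{#x, y#}"] by blast

lemma numeric_mul_cong: "numeric x1 \<Longrightarrow> numeric x2 \<Longrightarrow> numeric y \<Longrightarrow> mul_cong_at x1 x2 y"
  and numeric_mul_mono: "numeric x1 \<Longrightarrow> numeric x2 \<Longrightarrow> numeric y \<Longrightarrow> mul_mono_at x1 x2 y"
  using mul_main[of "{#x1, x2, y#}"] by blast+

lemma val_mul_cong:
  assumes "numeric x" "numeric x'" "numeric y" "numeric y'" "val x = val x'" "val y = val y'"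
  shows "val (x * y) = val (x' * y')"
  using mul_cong_atD[OF numeric_mul_cong[OF assms(1,2,3)] assms(5)]
    mul_cong_atD[OF numeric_mul_cong[OF assms(3,4,2)] assms(6)]
  by (simp add: game_mul_commute)

lemma val_mul_pos:
  assumes x: "numeric x" "0 < x" and y: "numeric y" "0 < y"
  shows "0 < val (x * y)"
  using y
proof (induction y rule: opts_induct)
  case (1 y)
  then have "\<not> y \<le> 0" by (simp add: less_game_def)
  then obtain b where b: "b \<in> lopts y" "0 \<le> b" by (auto simp: game_le_iff[of y 0])
  then have nb: "numeric b" using 1(2) numeric_lopts by blast
  have "0 < rect 0 x b y"
    using mul_mono_atD(1)[OF numeric_mul_mono[of 0 x y] x(2) b(1)] x(1) 1(2) by simp
  then have "val (x * b) < val (x * y)" by (simp add: rect_def)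
  moreover have "0 \<le> val (x * b)"
  proof (cases "0 < b")
    case True
    then show ?thesis using 1(1)[of b] b nb by (simp add: optsI less_imp_le)
  next
    case False
    then have "val b = val 0" using b unfolding val_eq_iff by (simp add: less_game_def)
    then have "val (x * b) = val (x * 0)" by (intro val_mul_cong) (simp_all add: x nb)
    then show ?thesis by simp
  qed
  ultimately show ?case by (rule le_less_trans[rotated])
qed


subsection \<open>The ordered field of surreal numbers\<close>

lemma game_eq_val: "game_eq x y \<longleftrightarrow> val x = val y"
  by (simp add: game_eq_def val_eq_iff)

quotient_type (overloaded) 'i surreal = "'i::infinite game" /
  partial: "\<lambda>x y. numeric x \<and> numeric y \<and> game_eq x y"
  morphisms rep_surreal surreal_of_game
proof (rule part_equivpI)
  show "\<exists>x :: 'i game. numeric x \<and> numeric x \<and> game_eq x x"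
    by (rule exI[of _ 0]) (simp add: game_eq_val)
qed (auto simp: symp_def transp_def game_eq_val)

instantiation surreal :: (infinite) linordered_idom
begin

lift_definition zero_surreal :: "'a surreal" is 0
  by (simp add: game_eq_val)
lift_definition one_surreal :: "'a surreal" is 1
  by (simp add: game_eq_val)
lift_definition plus_surreal :: "'a surreal \<Rightarrow> 'a surreal \<Rightarrow> 'a surreal" is "(+)"
  by (simp add: game_eq_val numeric_add)
lift_definition uminus_surreal :: "'a surreal \<Rightarrow> 'a surreal" is uminus
  by (simp add: game_eq_val numeric_neg)
lift_definition minus_surreal :: "'a surreal \<Rightarrow> 'a surreal \<Rightarrow> 'a surreal" is "(-)"
  by (simp add: game_eq_val numeric_minus)
lift_definition times_surreal :: "'a surreal \<Rightarrow> 'a surreal \<Rightarrow> 'a surreal" is "(*)"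
  by (auto simp: game_eq_val numeric_mul intro: val_mul_cong)
lift_definition less_eq_surreal :: "'a surreal \<Rightarrow> 'a surreal \<Rightarrow> bool" is "(\<le>)"
  by (auto simp: game_eq_def intro: order_trans)
lift_definition less_surreal :: "'a surreal \<Rightarrow> 'a surreal \<Rightarrow> bool" is "(<)"
  by (auto simp: game_eq_def less_game_def intro: order_trans)
definition abs_surreal :: "'a surreal \<Rightarrow> 'a surreal" where
  "\<bar>x :: 'a surreal\<bar> = (if x < 0 then - x else x)"
definition sgn_surreal :: "'a surreal \<Rightarrow> 'a surreal" where
  "sgn (x :: 'a surreal) = (if x = 0 then 0 else if 0 < x then 1 else - 1)"

instance
proof
  fix a b c :: "'a surreal"
  show "a + b + c = a + (b + c)"
    by transfer (simp add: game_eq_val numeric_add add.assoc)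
  show "a + b = b + a"
    by transfer (simp add: game_eq_val numeric_add add.commute)
  show "0 + a = a"
    by transfer (simp add: game_eq_val numeric_add)
  show "a + b - a = b" "a - b - c = a - (b + c)"
    by (transfer, simp add: game_eq_val numeric_add numeric_minus algebra_simps)+
  show "- a + a = 0" "a - b = a + - b"
    by (transfer, simp add: game_eq_val numeric_add numeric_neg numeric_minus)+
  show "0 * a = 0" "a * 0 = 0"
    by (transfer, simp add: game_eq_val numeric_mul)+
  show "a * b * c = a * (b * c)"
    by transfer (simp add: game_eq_val numeric_mul val_mul_assoc)
  show "a * b = b * a"
    by transfer (simp add: game_eq_val numeric_mul game_mul_commute)
  show "1 * a = a"
    by transfer (simp add: game_eq_val numeric_mul game_mul_commute[of 1])
  show "(a + b) * c = a * c + b * c"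
    by transfer (simp add: game_eq_val numeric_mul numeric_add val_mul_distrib)
  show "(0 :: 'a surreal) \<noteq> 1"
    by transfer (simp add: game_eq_def game_le_iff[of 1 0])
  show "a < b \<longleftrightarrow> a \<le> b \<and> \<not> b \<le> a"
    by transfer (simp add: less_game_def)
  show "a \<le> a" by transfer simp
  show "a \<le> b \<Longrightarrow> b \<le> c \<Longrightarrow> a \<le> c" by transfer (rule order_trans)
  show "a \<le> b \<Longrightarrow> b \<le> a \<Longrightarrow> a = b" by transfer (simp add: game_eq_def)
  show "a \<le> b \<or> b \<le> a" by transfer (simp add: numeric_total)
  show "a \<le> b \<Longrightarrow> c + a \<le> c + b" by transfer simp
  show "a < b \<Longrightarrow> 0 < c \<Longrightarrow> c * a < c * b"
  proof transfer
    fix a b c :: "'a game"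
    assume num: "numeric a \<and> numeric a \<and> game_eq a a" "numeric b \<and> numeric b \<and> game_eq b b"
      "numeric c \<and> numeric c \<and> game_eq c c" and lt: "a < b" "0 < c"
    have "val 0 < val (b - a)"
      unfolding val_simps using lt by simp
    then have "0 < b - a" by (simp only: val_less_iff)
    then have "0 < val (c * (b - a))"
      using num lt by (intro val_mul_pos) (simp_all add: numeric_minus)
    then have "val (c * a) < val (c * b)" unfolding val_mul_distrib by (simp del: val_less_iff)
    then show "c * a < c * b" by simp
  qed
  show "\<bar>a\<bar> = (if a < 0 then - a else a)" by (rule abs_surreal_def)
  show "sgn a = (if a = 0 then 0 else if 0 < a then 1 else - 1)" by (rule sgn_surreal_def)
qed

end

abbreviation sval :: "'i::infinite game \<Rightarrow> 'i surreal" where "sval \<equiv> surreal_of_game"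

lemma numeric_rep [simp]: "numeric (rep_surreal x)"
  and sval_rep [simp]: "sval (rep_surreal x) = x"
  using Quotient_surreal unfolding Quotient_def by metis+

lemma sval_eq_iff: "numeric x \<Longrightarrow> numeric y \<Longrightarrow> sval x = sval y \<longleftrightarrow> val x = val y"
  using Quotient_surreal[THEN Quotient_rel, of x y] by (simp add: game_eq_val)

lemma val_rep_sval: "numeric x \<Longrightarrow> val (rep_surreal (sval x)) = val x"
  by (subst sval_eq_iff[symmetric]) simp_all

lemma sval_surj: "\<exists>x. numeric x \<and> sval x = z"
  by (rule exI[of _ "rep_surreal z"]) simp

lemma sval_add: "numeric x \<Longrightarrow> numeric y \<Longrightarrow> sval (x + y) = sval x + sval y"
  by (simp add: plus_surreal.abs_eq game_eq_val)

lemma sval_minus: "numeric x \<Longrightarrow> numeric y \<Longrightarrow> sval (x - y) = sval x - sval y"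
  by (simp add: minus_surreal.abs_eq game_eq_val)

lemma sval_mul: "numeric x \<Longrightarrow> numeric y \<Longrightarrow> sval (x * y) = sval x * sval y"
  by (simp add: times_surreal.abs_eq game_eq_val)

lemma sval_zero: "sval 0 = 0" and sval_one: "sval 1 = 1"
  by (simp_all add: zero_surreal.abs_eq one_surreal.abs_eq)

lemma sval_le: "numeric x \<Longrightarrow> numeric y \<Longrightarrow> sval x \<le> sval y \<longleftrightarrow> x \<le> y"
  by (simp add: less_eq_surreal.abs_eq game_eq_val)

lemma sval_less: "numeric x \<Longrightarrow> numeric y \<Longrightarrow> sval x < sval y \<longleftrightarrow> x < y"
  by (simp add: less_surreal.abs_eq game_eq_val)

lemma sval_le_iff_opts:
  assumes x: "numeric x" and y: "numeric y"
  shows "sval x \<le> sval y \<longleftrightarrow> (\<forall>a\<in>lopts x. sval a < sval y) \<and> (\<forall>b\<in>ropts y. sval x < sval b)"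
  unfolding sval_le[OF x y] game_le_iff[of x y]
  using numeric_lopts[OF x] numeric_ropts[OF y] x y
  by (auto simp: sval_less numeric_not_le)

lemma sval_lopt: "numeric x \<Longrightarrow> a \<in> lopts x \<Longrightarrow> sval a < sval x"
  and sval_ropt: "numeric x \<Longrightarrow> b \<in> ropts x \<Longrightarrow> sval x < sval b"
  using numeric_lopt_less[of x a] sval_less[OF numeric_lopts[of x a], of x]
    numeric_ropt_less[of x b] sval_less[OF _ numeric_ropts[of x b], of x] by simp_all


subsection \<open>Cuts\<close>

definition surreal_cut_game :: "'i::infinite surreal set \<Rightarrow> 'i surreal set \<Rightarrow> 'i game" where
  "surreal_cut_game A B = mk_game (rep_surreal ` A) (rep_surreal ` B)"

definition surreal_cut :: "'i::infinite surreal set \<Rightarrow> 'i surreal set \<Rightarrow> 'i surreal" where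
  "surreal_cut A B = sval (surreal_cut_game A B)"

lemma opts_cut_game:
  assumes "small TYPE('i) A" "small TYPE('i) B"
  shows "lopts (surreal_cut_game A B :: 'i::infinite game) = rep_surreal ` A"
    and "ropts (surreal_cut_game A B :: 'i::infinite game) = rep_surreal ` B"
  using assms by (simp_all add: surreal_cut_game_def)

lemma numeric_cut_game:
  assumes "small TYPE('i) A" "small TYPE('i) B" "\<And>a b. a \<in> A \<Longrightarrow> b \<in> B \<Longrightarrow> a < b"
  shows "numeric (surreal_cut_game A B :: 'i::infinite game)"
proof (rule numericI_less)
  fix a b assume "a \<in> lopts (surreal_cut_game A B)" "b \<in> ropts (surreal_cut_game A B)"
  then obtain a' b' where "a = rep_surreal a'" "a' \<in> A" "b = rep_surreal b'" "b' \<in> B"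
    using opts_cut_game[OF assms(1,2)] by auto
  then show "a < b" using assms(3)[of a' b'] sval_less[of a b] by simp
qed (use opts_cut_game[OF assms(1,2)] in auto)


subsection \<open>Inverses\<close>

lemma small_UN:
  assumes I: "small TYPE('i::infinite) I" and A: "\<And>i. i \<in> I \<Longrightarrow> small TYPE('i) (A i)"
  shows "small TYPE('i) (\<Union>i\<in>I. A i)"
proof -
  obtain f where f: "A i \<subseteq> range (f i :: 'i \<Rightarrow> _)" if "i \<in> I" for i
    using A unfolding small_def by metis
  obtain g :: "'i \<Rightarrow> _" where g: "I \<subseteq> range g" using I by (auto simp: small_def)
  have "(\<Union>i\<in>I. A i) \<subseteq> range (\<lambda>(j, k). f (g j) k)"
  proof
    fix x assume "x \<in> (\<Union>i\<in>I. A i)"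
    then obtain i where i: "i \<in> I" "x \<in> A i" by blast
    then obtain j k where "i = g j" "x = f i k" using f g by blast
    then show "x \<in> range (\<lambda>(j, k). f (g j) k)" by (intro image_eqI[of _ _ "(j, k)"]) auto
  qed
  then show ?thesis by (rule small_via[OF _ inj_prod])
qed

text \<open>
  The options in Conway's recursive definition of the inverse of \<open>X > 0\<close>, without the separation into
  left and right ones; \<open>D\<close> contains the positive options of \<open>X\<close> paired with their inverses.
\<close>

primrec inv_approx :: "'i::infinite surreal \<Rightarrow> ('i surreal \<times> 'i surreal) set \<Rightarrow> nat \<Rightarrow> 'i surreal set" where
  "inv_approx X D 0 = {0}"
| "inv_approx X D (Suc n) = (\<lambda>((m, i), y). (1 + (m - X) * y) * i) ` (D \<times> inv_approx X D n)"

lemma small_inv_approx: "small TYPE('i) D \<Longrightarrow> small TYPE('i) (\<Union>n. inv_approx (X :: 'i::infinite surreal) D n)"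
proof (rule small_UN)
  show "small TYPE('i) (UNIV :: nat set)" by (rule small_countable) simp
  show "small TYPE('i) D \<Longrightarrow> small TYPE('i) (inv_approx X D n)" for n
    by (induction n) simp_all
qed

lemma positive_inverse:
  assumes x: "numeric (x :: 'i::infinite game)" and pos: "0 < sval x"
    and lzero: "\<And>a. a \<in> lopts x \<Longrightarrow> a = 0 \<or> 0 < sval a"
    and zero: "0 \<in> lopts x"
    and inv: "\<And>a. a \<in> opts x \<Longrightarrow> 0 < sval a \<Longrightarrow> \<exists>z. sval a * z = 1"
  shows "\<exists>z. sval x * z = 1"
proof -
  define X where "X = sval x"
  obtain iv where iv: "sval a * iv a = 1" if "a \<in> opts x" "0 < sval a" for a
    using inv by metis
  define D where "D = (\<lambda>a. (sval a, iv a)) ` {a \<in> opts x. 0 < sval a}"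
  define C where "C = (\<Union>n. inv_approx X D n)"
  have "small TYPE('i) (opts x)" by (simp add: opts_def)
  then have "small TYPE('i) {a \<in> opts x. 0 < sval a}" by (rule small_subset) auto
  then have smallC: "small TYPE('i) C"
    unfolding C_def by (intro small_inv_approx) (simp add: D_def)
  have zeroC: "0 \<in> C" unfolding C_def by (rule UN_I[of 0]) simp_all
  have stepC: "(1 + (sval a - X) * y) * iv a \<in> C" if "a \<in> opts x" "0 < sval a" "y \<in> C" for a y
  proof -
    obtain n where "y \<in> inv_approx X D n" using \<open>y \<in> C\<close> by (auto simp: C_def)
    then have "(1 + (sval a - X) * y) * iv a \<in> inv_approx X D (Suc n)"
      using that unfolding inv_approx.simps by (intro image_eqI[of _ _ "((sval a, iv a), y)"]) (auto simp: D_def)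
    then show ?thesis unfolding C_def by blast
  qed
  show ?thesis
  proof (cases "\<exists>y\<in>C. X * y = 1")
    case True
    then show ?thesis by (auto simp: X_def)
  next
    case False
    define A where "A = {y \<in> C. X * y < 1}"
    define B where "B = {y \<in> C. 1 < X * y}"
    have AB: "y \<in> A \<or> y \<in> B" if "y \<in> C" for y
      using that False unfolding A_def B_def by (auto simp: neq_iff)
    have small: "small TYPE('i) A" "small TYPE('i) B"
      by (auto intro: small_subset[OF smallC] simp: A_def B_def)
    define z where "z = surreal_cut_game A B"
    have z: "numeric z" unfolding z_def
    proof (rule numeric_cut_game[OF small])
      fix a b assume "a \<in> A" "b \<in> B"
      then have "X * a < X * b" unfolding A_def B_def by auto
      then show "a < b" using pos by (simp add: X_def)
    qed
    have lz: "lopts z = rep_surreal ` A" and rz: "ropts z = rep_surreal ` B"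
      unfolding z_def by (rule opts_cut_game[OF small])+
    define Z where "Z = sval z"
    have ltZ: "y < Z" if "y \<in> A" for y
      using sval_lopt[OF z, of "rep_surreal y"] that by (simp add: lz Z_def)
    have gtZ: "Z < y" if "y \<in> B" for y
      using sval_ropt[OF z, of "rep_surreal y"] that by (simp add: rz Z_def)
    have "0 \<in> A" using zeroC by (simp add: A_def)
    then have "0 < Z" by (rule ltZ)
    have xz: "numeric (x * z)" by (rule numeric_mul[OF x z])
    have val_opt: "sval (a * z + x * rep_surreal y - a * rep_surreal y) = sval a * Z + X * y - sval a * y"
      if "a \<in> opts x" for a y
    proof -
      have "numeric a" using x that by (rule numeric_opts)
      then show ?thesis
        by (simp add: sval_add sval_minus sval_mul numeric_mul numeric_add numeric_minus x z X_def Z_def)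
    qed
    have step: "\<exists>y'\<in>C. sval a * Z + X * y - sval a * y = 1 + sval a * (Z - y') \<and>
          sval a * (1 - X * y') = (sval a - X) * (1 - X * y)"
      if "a \<in> opts x" "0 < sval a" "y \<in> C" for a y
    proof (rule bexI[OF _ stepC[OF that]])
      define m i where "m = sval a" and "i = iv a"
      have "m * i = 1" unfolding m_def i_def by (rule iv[OF that(1,2)])
      then have e: "m * ((1 + (m - X) * y) * i) = 1 + (m - X) * y"
        by (simp add: mult.left_commute mult.commute[of _ i] flip: mult.assoc)
      have "m * Z + X * y - m * y = 1 + m * Z - (1 + (m - X) * y)" by (simp add: algebra_simps)
      also have "\<dots> = 1 + m * (Z - (1 + (m - X) * y) * i)"
        unfolding right_diff_distrib e by simp
      moreover have "m * (1 - X * ((1 + (m - X) * y) * i)) = m - X * (m * ((1 + (m - X) * y) * i))"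
        by (simp add: algebra_simps)
      moreover have "\<dots> = (m - X) * (1 - X * y)" unfolding e by (simp add: algebra_simps)
      ultimately show "sval a * Z + X * y - sval a * y = 1 + sval a * (Z - (1 + (sval a - X) * y) * iv a) \<and>
        sval a * (1 - X * ((1 + (sval a - X) * y) * iv a)) = (sval a - X) * (1 - X * y)"
        unfolding m_def i_def by simp
    qed
    have up: "sval a * Z + X * y - sval a * y < 1"
      if h: "a \<in> opts x" "0 < sval a" "y \<in> C" "0 < (X - sval a) * (1 - X * y)" for a y
    proof -
      obtain y' where y': "y' \<in> C" "sval a * Z + X * y - sval a * y = 1 + sval a * (Z - y')"
        "sval a * (1 - X * y') = (sval a - X) * (1 - X * y)" using step[OF h(1-3)] by blast
      have "(sval a - X) * (1 - X * y) = - ((X - sval a) * (1 - X * y))" by (simp add: algebra_simps)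
      then have "sval a * (1 - X * y') < 0" using that(4) y'(3) by simp
      then have "1 - X * y' < 0" using that(2) by (simp add: mult_less_0_iff)
      then have "y' \<in> B" using y'(1) by (simp add: B_def)
      then have "sval a * (Z - y') < 0" using gtZ that(2) by (simp add: mult_less_0_iff)
      then show ?thesis using y'(2) by simp
    qed
    have down: "1 < sval a * Z + X * y - sval a * y"
      if h: "a \<in> opts x" "0 < sval a" "y \<in> C" "(X - sval a) * (1 - X * y) < 0" for a y
    proof -
      obtain y' where y': "y' \<in> C" "sval a * Z + X * y - sval a * y = 1 + sval a * (Z - y')"
        "sval a * (1 - X * y') = (sval a - X) * (1 - X * y)" using step[OF h(1-3)] by blast
      have "(sval a - X) * (1 - X * y) = - ((X - sval a) * (1 - X * y))" by (simp add: algebra_simps)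
      then have "0 < sval a * (1 - X * y')" using that(4) y'(3) by simp
      then have "0 < 1 - X * y'" using that(2) by (simp add: zero_less_mult_iff)
      then have "y' \<in> A" using y'(1) by (simp add: A_def)
      then have "0 < sval a * (Z - y')" using ltZ that(2) by simp
      then show ?thesis using y'(2) by simp
    qed
    have la: "sval a < X" if "a \<in> lopts x" for a using sval_lopt[OF x that] by (simp add: X_def)
    have ra: "X < sval a" "0 < sval a" if "a \<in> ropts x" for a
      using sval_ropt[OF x that] pos by (simp_all add: X_def)
    have l1: "sval p < 1" if p: "p \<in> lopts (x * z)" for p
    proof -
      obtain a y where p: "p = a * z + x * rep_surreal y - a * rep_surreal y"
        and ay: "a \<in> lopts x \<and> y \<in> A \<or> a \<in> ropts x \<and> y \<in> B"
        using p by (auto simp: lopts_mul lz rz)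
      then have a: "a \<in> opts x" by (auto simp: opts_def)
      show ?thesis
      proof (cases "a = 0")
        case True
        then have "y \<in> A" using ay ra(2)[of a] by (auto simp: sval_zero)
        then show ?thesis unfolding p val_opt[OF a] using True by (simp add: sval_zero A_def)
      next
        case False
        then have "0 < sval a" using ay lzero ra by blast
        moreover have "0 < (X - sval a) * (1 - X * y)"
          using ay la[of a] ra(1)[of a] by (auto simp: A_def B_def zero_less_mult_iff)
        moreover have "y \<in> C" using ay by (auto simp: A_def B_def)
        ultimately show ?thesis unfolding p val_opt[OF a] by (intro up[OF a])
      qed
    qed
    have r1: "1 < sval p" if p: "p \<in> ropts (x * z)" for p
    proof -
      obtain a y where p: "p = a * z + x * rep_surreal y - a * rep_surreal y"
        and ay: "a \<in> lopts x \<and> y \<in> B \<or> a \<in> ropts x \<and> y \<in> A"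
        using p by (auto simp: ropts_mul lz rz)
      then have a: "a \<in> opts x" by (auto simp: opts_def)
      show ?thesis
      proof (cases "a = 0")
        case True
        then have "y \<in> B" using ay ra(2)[of a] by (auto simp: sval_zero)
        then show ?thesis unfolding p val_opt[OF a] using True by (simp add: sval_zero B_def)
      next
        case False
        then have "0 < sval a" using ay lzero ra by blast
        moreover have "(X - sval a) * (1 - X * y) < 0"
          using ay la[of a] ra(1)[of a] by (auto simp: A_def B_def mult_less_0_iff)
        moreover have "y \<in> C" using ay by (auto simp: A_def B_def)
        ultimately show ?thesis unfolding p val_opt[OF a] by (intro down[OF a])
      qed
    qed
    have "sval (x * z) \<le> sval 1"
      unfolding sval_le_iff_opts[OF xz numeric_one] using l1 by (simp add: sval_one)
    moreover have "sval 1 \<le> sval (x * z)"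
      unfolding sval_le_iff_opts[OF numeric_one xz]
      using r1 pos \<open>0 < Z\<close> by (simp add: sval_one sval_zero sval_mul x z Z_def)
    ultimately have "X * Z = 1" by (simp add: sval_mul x z X_def Z_def sval_one)
    then show ?thesis unfolding X_def by blast
  qed
qed

lemma surreal_inverse_pos: "numeric x \<Longrightarrow> 0 < sval x \<Longrightarrow> \<exists>z. sval (x :: 'i::infinite game) * z = 1"
proof (induction x rule: opts_induct)
  case (1 x)
  define P where "P = {a \<in> lopts x. 0 < sval a}"
  define y where "y = mk_game (insert 0 P) (ropts x)"
  have "small TYPE('i) P" unfolding P_def by (rule small_subset[OF small_lopts]) auto
  then have "small TYPE('i) ({0} \<union> P)" by (intro small_Un) simp_all
  then have ly: "lopts y = insert 0 P" and ry: "ropts y = ropts x"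
    by (simp_all add: y_def)
  have nl: "numeric a" if "a \<in> lopts x" for a using that 1(2) numeric_lopts by blast
  have nr: "numeric a" if "a \<in> ropts x" for a using that 1(2) numeric_ropts by blast
  have y: "numeric y"
  proof (rule numericI_less)
    fix a b assume "a \<in> lopts y" "b \<in> ropts y"
    moreover have "sval a < sval x" if "a \<in> lopts y"
      using that sval_lopt[OF 1(2)] 1(3) by (auto simp: ly P_def sval_zero)
    ultimately have "sval a < sval b" using sval_ropt[OF 1(2), of b] ry by auto
    then show "a < b" using \<open>a \<in> lopts y\<close> \<open>b \<in> ropts y\<close> nl nr by (auto simp: sval_less ly ry P_def)
  qed (auto simp: ly ry P_def nl nr)
  have "sval y \<le> sval x"
    unfolding sval_le_iff_opts[OF y 1(2)] using 1(2,3) sval_lopt sval_ropt[OF y]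
    by (auto simp: ly ry P_def sval_zero)
  moreover have "sval x \<le> sval y"
    unfolding sval_le_iff_opts[OF 1(2) y]
  proof (intro conjI ballI)
    fix a assume a: "a \<in> lopts x"
    have "0 < sval y" using sval_lopt[OF y, of 0] by (simp add: ly sval_zero)
    then show "sval a < sval y" using sval_lopt[OF y, of a] a by (cases "0 < sval a") (auto simp: ly P_def)
  qed (use sval_ropt[OF 1(2)] ry in auto)
  ultimately have eq: "sval y = sval x" by simp
  have "\<exists>z. sval y * z = 1"
  proof (rule positive_inverse[OF y])
    show "0 < sval y" using 1(3) eq by simp
    show "a = 0 \<or> 0 < sval a" if "a \<in> lopts y" for a using that by (auto simp: ly P_def)
    show "0 \<in> lopts y" by (simp add: ly)
    show "\<exists>z. sval a * z = 1" if "a \<in> opts y" "0 < sval a" for a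
      using that 1(1)[of a] nl nr by (auto simp: opts_def ly ry P_def sval_zero)
  qed
  then show ?case by (simp add: eq)
qed

lemma surreal_inverse_ex:
  assumes "(x :: 'i::infinite surreal) \<noteq> 0"
  shows "\<exists>z. x * z = 1"
proof -
  have pos: "\<exists>z. x * z = 1" if "0 < x" for x :: "'i surreal"
    using surreal_inverse_pos[of "rep_surreal x"] that by simp
  show ?thesis
  proof (cases "0 < x")
    case False
    then have "0 < - x" using assms by simp
    then obtain z where "- x * z = 1" using pos by blast
    then have "x * - z = 1" by simp
    then show ?thesis by blast
  qed (rule pos)
qed

instantiation surreal :: (infinite) linordered_field
begin

definition inverse_surreal :: "'a surreal \<Rightarrow> 'a surreal" where
  "inverse (x :: 'a surreal) = (if x = 0 then 0 else (THE z. x * z = 1))"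

definition divide_surreal :: "'a surreal \<Rightarrow> 'a surreal \<Rightarrow> 'a surreal" where
  "(x :: 'a surreal) div y = x * inverse y"

instance
proof
  fix a b :: "'a surreal"
  assume "a \<noteq> 0"
  then have "\<exists>!z. a * z = 1"
    using surreal_inverse_ex[of a] by (metis mult_cancel_left)
  then have "a * (THE z. a * z = 1) = 1" by (rule theI')
  then show "inverse a * a = 1"
    using \<open>a \<noteq> 0\<close> by (simp add: inverse_surreal_def mult.commute)
qed (simp_all add: inverse_surreal_def divide_surreal_def)

end


subsection \<open>Real numbers as surreal numbers\<close>

definition surreal_of_real :: "real \<Rightarrow> 'i::infinite surreal" where
  "surreal_of_real r = surreal_cut {of_rat q |q. of_rat q < r} {of_rat q |q. r < of_rat q}"

text \<open>\<open>near z t\<close>: the surreal \<open>z\<close> is infinitely close to the real \<open>t\<close>.\<close>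

definition near :: "'i::infinite surreal \<Rightarrow> real \<Rightarrow> bool" where
  "near z t \<longleftrightarrow> (\<forall>q. of_rat q < t \<longrightarrow> of_rat q < z) \<and> (\<forall>q. t < of_rat q \<longrightarrow> z < of_rat q)"

lemma nearI:
  "(\<And>q. of_rat q < t \<Longrightarrow> of_rat q < z) \<Longrightarrow> (\<And>q. t < of_rat q \<Longrightarrow> z < of_rat q) \<Longrightarrow> near z t"
  by (simp add: near_def)

lemma nearD: "near z t \<Longrightarrow> of_rat q < t \<Longrightarrow> of_rat q < z" "near z t \<Longrightarrow> t < of_rat q \<Longrightarrow> z < of_rat q"
  by (simp_all add: near_def)

lemma near_of_rat: "near (of_rat q) (of_rat q)"
  by (simp add: near_def of_rat_less)

lemma near_add:
  assumes "near z t" "near w u" shows "near (z + w) (t + u)"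
proof (rule nearI)
  fix q assume q: "of_rat q < t + u"
  obtain p where p: "of_rat q - u < of_rat p" "of_rat p < t"
    using of_rat_dense[of "of_rat q - u" t] q by auto
  have "of_rat p < z" by (rule nearD(1)[OF assms(1) p(2)])
  moreover have "of_rat (q - p) < w"
    by (rule nearD(1)[OF assms(2)]) (use p in \<open>simp add: of_rat_diff\<close>)
  ultimately show "of_rat q < z + w" by (simp add: of_rat_diff)
next
  fix q assume q: "t + u < of_rat q"
  obtain p where p: "t < of_rat p" "of_rat p < of_rat q - u"
    using of_rat_dense[of t "of_rat q - u"] q by auto
  have "z < of_rat p" by (rule nearD(2)[OF assms(1) p(1)])
  moreover have "w < of_rat (q - p)"
    by (rule nearD(2)[OF assms(2)]) (use p in \<open>simp add: of_rat_diff\<close>)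
  ultimately show "z + w < of_rat q" by (simp add: of_rat_diff)
qed

lemma near_minus: "near z t \<Longrightarrow> near (- z) (- t)"
proof (rule nearI)
  fix q assume z: "near z t"
  show "of_rat q < - z" if "of_rat q < - t"
    using nearD(2)[OF z, of "- q"] that by (simp add: of_rat_minus)
  show "- z < of_rat q" if "- t < of_rat q"
    using nearD(1)[OF z, of "- q"] that by (simp add: of_rat_minus)
qed

lemma near_diff: "near z t \<Longrightarrow> near w u \<Longrightarrow> near (z - w) (t - u)"
  using near_add[OF _ near_minus, of z t w u] by simp

lemma near_mult_rat_pos:
  assumes "0 < c" "near z t" shows "near (of_rat c * z) (of_rat c * t)"
proof (rule nearI)
  have c: "0 < (of_rat c :: real)" "0 < (of_rat c :: 'a surreal)" using assms(1) by simp_all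
  fix q
  show "of_rat q < of_rat c * z" if "of_rat q < of_rat c * t"
  proof -
    have "of_rat (q / c) < t" using that c by (simp add: of_rat_divide field_simps)
    from nearD(1)[OF assms(2) this] show ?thesis using c by (simp add: of_rat_divide field_simps)
  qed
  show "of_rat c * z < of_rat q" if "of_rat c * t < of_rat q"
  proof -
    have "t < of_rat (q / c)" using that c by (simp add: of_rat_divide field_simps)
    from nearD(2)[OF assms(2) this] show ?thesis using c by (simp add: of_rat_divide field_simps)
  qed
qed

lemma near_pos: "near z t \<Longrightarrow> 0 < t \<Longrightarrow> 0 < z"
  using nearD(1)[of z t 0] by simp

lemma near_mult_pos:
  assumes z: "near z t" and w: "near w u" and tu: "0 < t" "0 < u"
  shows "near (z * w) (t * u)"
proof (rule nearI)
  have zw: "0 < z" "0 < w" using near_pos z w tu by blast+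
  fix q
  {
    assume q: "of_rat q < t * u"
    have "max (of_rat q / u) 0 < t" using q tu by (simp add: field_simps)
    from of_rat_dense[OF this] obtain p where p: "max (of_rat q / u) 0 < of_rat p" "of_rat p < t" by blast
    then have p0: "0 < (of_rat p :: real)" by simp
    have "max (of_rat q / of_rat p) 0 < u" using p p0 tu by (simp add: field_simps)
    from of_rat_dense[OF this] obtain p' where p': "max (of_rat q / of_rat p) 0 < real_of_rat p'" "of_rat p' < u" by blast
    have "(of_rat q :: real) < of_rat (p * p')" using p' p0 by (simp add: field_simps of_rat_mult)
    then have "of_rat q < (of_rat (p * p') :: 'a surreal)" by (simp only: of_rat_less)
    also have "\<dots> = of_rat p * of_rat p'" by (rule of_rat_mult)
    also have "\<dots> < z * w"
      using nearD(1)[OF z p(2)] nearD(1)[OF w p'(2)] p0 p' zw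
      by (intro mult_strict_mono) simp_all
    finally show "of_rat q < z * w" .
  next
    assume q: "t * u < of_rat q"
    have "t < of_rat q / u" using q tu by (simp add: field_simps)
    from of_rat_dense[OF this] obtain p where p: "t < of_rat p" "of_rat p < of_rat q / u" by blast
    then have p0: "0 < (of_rat p :: real)" using tu by linarith
    have "u < of_rat q / of_rat p" using p p0 tu by (simp add: field_simps)
    from of_rat_dense[OF this] obtain p' where p': "u < of_rat p'" "real_of_rat p' < of_rat q / of_rat p" by blast
    have "(of_rat (p * p') :: real) < of_rat q" using p' p0 by (simp add: field_simps of_rat_mult)
    then have *: "of_rat (p * p') < (of_rat q :: 'a surreal)" by (simp only: of_rat_less)
    have "z * w < of_rat p * of_rat p'"
      using nearD(2)[OF z p(1)] nearD(2)[OF w p'(1)] p0 zw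
      by (intro mult_strict_mono) simp_all
    also have "\<dots> = of_rat (p * p')" by (simp add: of_rat_mult)
    also note *
    finally show "z * w < of_rat q" .
  }
qed

lemma near_mult:
  assumes "near z t" "near w u" shows "near (z * w) (t * u)"
proof -
  obtain c where c: "max (max (- t) (- u)) 0 < of_rat c"
    using of_rat_dense[of "max (max (- t) (- u)) 0" "max (max (- t) (- u)) 0 + 1"] by auto
  then have c0: "0 < c" by simp
  have n: "near (z + of_rat c) (t + of_rat c)" "near (w + of_rat c) (u + of_rat c)"
    by (rule near_add[OF _ near_of_rat], rule assms)+
  have "near ((z + of_rat c) * (w + of_rat c) - of_rat c * (z + w) - of_rat (c * c))
             ((t + of_rat c) * (u + of_rat c) - of_rat c * (t + u) - of_rat (c * c))"
    using c by (intro near_diff near_mult_pos near_mult_rat_pos near_add near_of_rat n assms c0) auto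
  then show ?thesis by (simp add: of_rat_mult algebra_simps)
qed

definition real_game :: "real \<Rightarrow> 'i::infinite game" where
  "real_game r = surreal_cut_game {of_rat q |q. of_rat q < r} {of_rat q |q. r < of_rat q}"

lemma real_cut_small:
  "small TYPE('i::infinite) {of_rat q |q. P q}"
proof (rule small_countable)
  have *: "{of_rat q |q. P q} = of_rat ` {q. P q}" by auto
  show "countable {of_rat q |q. P q}" unfolding * by (rule countable_image[OF countableI_type])
qed

lemma opts_real_game:
  "lopts (real_game r) = rep_surreal ` {of_rat q |q. of_rat q < r}"
  "ropts (real_game r) = rep_surreal ` {of_rat q |q. r < of_rat q}"
  unfolding real_game_def by (rule opts_cut_game; rule real_cut_small)+

lemma numeric_real_game [simp]: "numeric (real_game r)"
  unfolding real_game_def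
proof (rule numeric_cut_game; (rule real_cut_small)?)
  fix a b :: "'a surreal"
  assume "a \<in> {of_rat q |q. of_rat q < r}" "b \<in> {of_rat q |q. r < of_rat q}"
  then obtain p q where pq: "a = of_rat p" "b = of_rat q" "of_rat p < r" "r < of_rat q" by blast
  then have "real_of_rat p < of_rat q" by (blast intro: less_trans)
  then show "a < b" by (simp add: pq of_rat_less)
qed

lemma surreal_of_real_sval: "surreal_of_real r = sval (real_game r)"
  by (simp add: surreal_of_real_def surreal_cut_def real_game_def)

lemma near_surreal_of_real: "near (surreal_of_real r) r"
proof (rule nearI)
  show "of_rat q < (surreal_of_real r :: 'a surreal)" if "of_rat q < r" for q
    using sval_lopt[OF numeric_real_game[of r], of "rep_surreal (of_rat q)"] that
    by (auto simp: opts_real_game surreal_of_real_sval)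
  show "surreal_of_real r < (of_rat q :: 'a surreal)" if "r < of_rat q" for q
    using sval_ropt[OF numeric_real_game[of r], of "rep_surreal (of_rat q)"] that
    by (auto simp: opts_real_game surreal_of_real_sval)
qed

lemma near_less: "near z t \<Longrightarrow> near w u \<Longrightarrow> t < u \<Longrightarrow> z < w"
  using of_rat_dense[of t u] nearD(1)[of w u] nearD(2)[of z t] less_trans by blast

lemma sval_eq_surreal_of_realI:
  assumes x: "numeric x" and near: "near (sval x) r"
    and l: "\<And>a. a \<in> lopts x \<Longrightarrow> sval a < surreal_of_real r"
    and rr: "\<And>b. b \<in> ropts x \<Longrightarrow> surreal_of_real r < sval b"
  shows "sval x = surreal_of_real r"
proof (rule antisym)
  show "sval x \<le> surreal_of_real r"
    unfolding surreal_of_real_sval sval_le_iff_opts[OF x numeric_real_game]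
    using l nearD(2)[OF near] by (auto simp: opts_real_game surreal_of_real_sval)
  show "surreal_of_real r \<le> sval x"
    unfolding surreal_of_real_sval sval_le_iff_opts[OF numeric_real_game x]
    using rr nearD(1)[OF near] by (auto simp: opts_real_game surreal_of_real_sval)
qed

lemma surreal_of_real_1: "surreal_of_real 1 = 1"
proof -
  have "sval 1 = surreal_of_real 1"
  proof (rule sval_eq_surreal_of_realI)
    show "near (sval 1) 1" using near_of_rat[of 1] by (simp add: sval_one)
    show "sval a < surreal_of_real 1" if "a \<in> lopts 1" for a
      using that near_pos[OF near_surreal_of_real, of 1] by (simp add: sval_zero)
  qed simp_all
  then show ?thesis by (simp add: sval_one)
qed

lemma surreal_of_real_add: "surreal_of_real (r + s) = surreal_of_real r + surreal_of_real s"
proof -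
  let ?x = "real_game r" and ?y = "real_game s"
  have "sval (?x + ?y) = surreal_of_real (r + s)"
  proof (rule sval_eq_surreal_of_realI)
    show "near (sval (?x + ?y)) (r + s)"
      by (simp add: sval_add near_add near_surreal_of_real flip: surreal_of_real_sval)
    show "sval a < surreal_of_real (r + s)" if "a \<in> lopts (?x + ?y)" for a
      using that
      by (auto simp: lopts_add opts_real_game sval_add
          intro!: near_less[OF near_add[OF near_of_rat near_surreal_of_real] near_surreal_of_real]
            near_less[OF near_add[OF near_surreal_of_real near_of_rat] near_surreal_of_real]
          simp flip: surreal_of_real_sval)
    show "surreal_of_real (r + s) < sval a" if "a \<in> ropts (?x + ?y)" for a
      using that
      by (auto simp: ropts_add opts_real_game sval_add
          intro!: near_less[OF near_surreal_of_real near_add[OF near_of_rat near_surreal_of_real]]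
            near_less[OF near_surreal_of_real near_add[OF near_surreal_of_real near_of_rat]]
          simp flip: surreal_of_real_sval)
  qed (simp add: numeric_add)
  then show ?thesis by (metis numeric_real_game sval_add surreal_of_real_sval)
qed

lemma surreal_of_real_mult: "surreal_of_real (r * s) = surreal_of_real r * surreal_of_real s"
proof -
  let ?x = "real_game r :: 'a game" and ?y = "real_game s :: 'a game"
  let ?X = "surreal_of_real r :: 'a surreal" and ?Y = "surreal_of_real s :: 'a surreal"
  have val_opt: "sval (rep_surreal a * ?y + ?x * rep_surreal b - rep_surreal a * rep_surreal b) =
      a * ?Y + ?X * b - a * b" for a b
    by (simp add: sval_add sval_minus sval_mul numeric_mul numeric_add numeric_minus surreal_of_real_sval)
  have near_opt: "near (of_rat p * ?Y + ?X * of_rat q - of_rat p * of_rat q)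
      (r * s - (r - of_rat p) * (s - of_rat q))" for p q
  proof -
    have "near (of_rat p * ?Y + ?X * of_rat q - of_rat p * of_rat q)
        (of_rat p * s + r * of_rat q - of_rat p * of_rat q)"
      by (intro near_diff near_add near_mult near_of_rat near_surreal_of_real)
    then show ?thesis by (simp add: algebra_simps)
  qed
  have "sval (?x * ?y) = surreal_of_real (r * s)"
  proof (rule sval_eq_surreal_of_realI)
    show "near (sval (?x * ?y)) (r * s)"
      by (simp add: sval_mul near_mult near_surreal_of_real flip: surreal_of_real_sval)
    show "sval c < surreal_of_real (r * s)" if mem: "c \<in> lopts (?x * ?y)" for c
    proof -
      obtain p q where c: "c = rep_surreal (of_rat p) * ?y + ?x * rep_surreal (of_rat q)
            - rep_surreal (of_rat p) * rep_surreal (of_rat q)"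
        and "of_rat p < r \<and> of_rat q < s \<or> r < of_rat p \<and> s < of_rat q"
        using mem by (auto simp: lopts_mul opts_real_game)
      then have "0 < (r - of_rat p) * (s - of_rat q)" by (auto simp: zero_less_mult_iff)
      then show ?thesis unfolding c val_opt
        by (intro near_less[OF near_opt near_surreal_of_real]) simp
    qed
    show "surreal_of_real (r * s) < sval c" if mem: "c \<in> ropts (?x * ?y)" for c
    proof -
      obtain p q where c: "c = rep_surreal (of_rat p) * ?y + ?x * rep_surreal (of_rat q)
            - rep_surreal (of_rat p) * rep_surreal (of_rat q)"
        and "of_rat p < r \<and> s < of_rat q \<or> r < of_rat p \<and> of_rat q < s"
        using mem by (auto simp: ropts_mul opts_real_game)
      then have "(r - of_rat p) * (s - of_rat q) < 0" by (auto simp: mult_less_0_iff)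
      then show ?thesis unfolding c val_opt
        by (intro near_less[OF near_surreal_of_real near_opt]) simp
    qed
  qed (simp add: numeric_mul)
  then show ?thesis by (metis numeric_real_game sval_mul surreal_of_real_sval)
qed

instantiation surreal :: (infinite) real_field
begin

definition scaleR_surreal :: "real \<Rightarrow> 'a surreal \<Rightarrow> 'a surreal" where
  "r *\<^sub>R (x :: 'a surreal) = surreal_of_real r * x"

instance
  by standard
    (simp_all add: scaleR_surreal_def surreal_of_real_1 surreal_of_real_add surreal_of_real_mult
      distrib_left distrib_right mult.assoc mult.left_commute)

end

lemma of_real_surreal: "of_real r = (surreal_of_real r :: 'i::infinite surreal)"
  by (simp add: of_real_def scaleR_surreal_def)


section \<open>Knuth and Roman coefficients\<close>

text \<open>
  The parameter ranges over a field that contains the reals, embedded by \<open>of_real\<close>; this covers the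
  complex numbers and the surreal numbers.
\<close>

definition knuth_factorial :: "'a::real_field \<Rightarrow> real \<Rightarrow> 'a" where
  "knuth_factorial \<epsilon> a =
     (if a \<in> \<int> \<and> a < 0
      then (- 1) powi (\<lfloor>a\<rfloor> - 1) * (1 / \<epsilon>) / fact (nat (- \<lfloor>a\<rfloor> - 1))
      else of_real (Gamma (a + 1)))"

definition knuth_coeff :: "'a::real_field \<Rightarrow> real \<Rightarrow> real \<Rightarrow> 'a" where
  "knuth_coeff \<epsilon> a b = knuth_factorial \<epsilon> a / (knuth_factorial \<epsilon> b * knuth_factorial \<epsilon> (a - b))"

definition roman_factorial :: "int \<Rightarrow> real" where
  "roman_factorial n =
     (if n \<ge> 0 then fact (nat n) else (- 1) powi (n + 1) / fact (nat (- n - 1)))"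

definition roman_coeff :: "int \<Rightarrow> int \<Rightarrow> real" where
  "roman_coeff n k = roman_factorial n / (roman_factorial k * roman_factorial (n - k))"

end

theory Submission
  imports Defs
begin

text \<open>
  At an integer the Knuth factorial is the Roman factorial, with one additional factor
  \<open>\<omega> = 1/\<epsilon>\<close> exactly when the integer is negative (\<open>knuth_factorial_of_int\<close>). So the Knuth
  coefficient is the Roman coefficient times a power of \<open>\<epsilon>\<close>, and the exponent counts
  the negative numbers among \<open>k\<close> and \<open>n - k\<close> minus those among \<open>n\<close> (\<open>knuth_coeff_of_int\<close>). This
  exponent is \<open>0\<close> in the first three regions and \<open>1\<close> in the other three; since
  \<open>n = k + (n - k)\<close>, no other pattern of signs can occur. It remains to evaluate the real number
  \<open>roman_coeff n k\<close> in each region. For suitable natural numbers \<open>a\<close> and \<open>b\<close> it is, up to sign,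
  \<open>(a + b)! / (a! b!)\<close> in the first three regions. In the other three the quotient is inverted and
  its arguments no longer add up: it is \<open>a! b! / (a + b + 1)!\<close>, and completing it to the inverse
  of a binomial coefficient produces the factor \<open>k\<close> or \<open>n - k\<close> in the denominator. Only field laws
  and the embedding of the reals are used, so the formulas hold over every real field and are
  specialised to the complex and the surreal numbers at the end.
\<close>

section \<open>Reduction to Roman coefficients\<close>

text \<open>
  The sign \<open>(-1)^(m-1)\<close> of the Knuth factorial agrees with the sign \<open>(-1)^(m+1)\<close> of the Roman
  factorial, because the exponents differ by \<open>2\<close>; at nonnegative integers both are values of
  the Gamma function.
\<close>

lemma knuth_factorial_of_int:
  fixes \<epsilon> :: "'a::real_field"
  shows "knuth_factorial \<epsilon> (of_int m) = of_real (roman_factorial m) / \<epsilon> ^ of_bool (m < 0)"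
proof (cases "m < 0")
  case True
  then show ?thesis
    by (simp add: knuth_factorial_def roman_factorial_def power_int_minus_left)
next
  case False
  then obtain j where "m = int j" by (metis not_less nonneg_int_cases)
  then show ?thesis
    using Gamma_fact[where 'a = real, of j]
    by (simp add: knuth_factorial_def roman_factorial_def add.commute)
qed

lemma knuth_coeff_of_int:
  fixes \<epsilon> :: "'a::real_field"
  shows "knuth_coeff \<epsilon> (of_int n) (of_int k) =
    \<epsilon> ^ (of_bool (k < 0) + of_bool (n < k)) / \<epsilon> ^ of_bool (n < 0) * of_real (roman_coeff n k)"
proof -
  have "n - k < 0 \<longleftrightarrow> n < k" by simp
  then show ?thesis
    using knuth_factorial_of_int[of \<epsilon> "n - k"]
    by (simp add: knuth_coeff_def roman_coeff_def knuth_factorial_of_int power_add)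
qed

section \<open>Roman coefficients in the six regions\<close>

lemma roman_factorial_of_nat: "roman_factorial (int a) = fact a"
  by (simp add: roman_factorial_def)

lemma roman_factorial_neg: "roman_factorial (- int a - 1) = (- 1) ^ a / fact a"
  by (simp add: roman_factorial_def power_int_minus_left minus_one_power_iff)

lemma real_binomial_add: "real ((a + b) choose a) = fact (a + b) / (fact a * fact b)"
  by (simp add: binomial_fact)

lemma roman_coeff_region1:
  assumes "n \<ge> k" "k \<ge> 0"
  shows "roman_coeff n k = real (nat n choose nat k)"
proof -
  define a b where "a = nat k" and "b = nat (n - k)"
  have eqs: "k = int a" "n - k = int b" "n = int (a + b)" "nat n = a + b" "nat k = a"
    using assms by (auto simp: a_def b_def)
  show ?thesis
    unfolding roman_coeff_def eqs(2,4,5) real_binomial_add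
    unfolding eqs(1,3) roman_factorial_of_nat by simp
qed

lemma roman_coeff_region2:
  assumes "k \<ge> 0" "0 > n"
  shows "roman_coeff n k = (- 1) powi k * real (nat (- n + k - 1) choose nat k)"
proof -
  define a b where "a = nat k" and "b = nat (- n - 1)"
  have eqs: "k = int a" "n - k = - int (a + b) - 1" "n = - int b - 1"
    "nat (- n + k - 1) = a + b" "nat k = a"
    using assms by (auto simp: a_def b_def)
  show ?thesis
    unfolding roman_coeff_def eqs(2,4,5) real_binomial_add
    unfolding eqs(1,3) roman_factorial_of_nat roman_factorial_neg
    by (simp add: minus_one_power_iff power_int_minus_left)
qed

lemma roman_coeff_region3:
  assumes "0 > n" "n \<ge> k"
  shows "roman_coeff n k = (- 1) powi (n + k) * real (nat (- k - 1) choose nat (n - k))"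
proof -
  define a b where "a = nat (n - k)" and "b = nat (- n - 1)"
  have eqs: "n - k = int a" "nat (- k - 1) = a + b" "n = - int b - 1" "k = - int (a + b) - 1"
    using assms by (auto simp: a_def b_def)
  have sign: "even (n + k) \<longleftrightarrow> even a" unfolding eqs(3,4) by simp
  show ?thesis
    unfolding roman_coeff_def power_int_minus_left sign eqs(1,2) nat_int real_binomial_add
    unfolding eqs(3,4) roman_factorial_of_nat roman_factorial_neg
    by (simp add: minus_one_power_iff)
qed

text \<open>
  In the last three regions the factor \<open>(b + 1)!\<close> (or \<open>(a + 1)!\<close>) of the binomial coefficient
  is the \<open>b!\<close> (or \<open>a!\<close>) of the Roman coefficient times the absolute value of the negative
  integer \<open>n - k\<close> or \<open>k\<close>. This negative integer in the denominator accounts for the surplus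
  factor and for one sign.
\<close>

lemma roman_coeff_region4:
  assumes "k > n" "n \<ge> 0"
  shows "roman_coeff n k = (- 1) powi (n + k) / (real_of_int (n - k) * real (nat k choose nat n))"
proof -
  define a b where "a = nat n" and "b = nat (k - n - 1)"
  have eqs: "n - k = - int b - 1" "nat k = a + Suc b" "nat n = a" "n = int a"
    "k = int (a + Suc b)"
    using assms by (auto simp: a_def b_def)
  have sign: "even (n + k) \<longleftrightarrow> odd b" unfolding eqs(4,5) by simp
  show ?thesis
    unfolding roman_coeff_def power_int_minus_left sign eqs(1,2,3) real_binomial_add
    unfolding eqs(4,5) roman_factorial_of_nat roman_factorial_neg
    by (simp add: minus_one_power_iff divide_simps del: of_nat_Suc)
qed

lemma roman_coeff_region5:
  assumes "n \<ge> 0" "0 > k"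
  shows "roman_coeff n k = (- 1) powi k / (real_of_int k * real (nat (n - k) choose nat n))"
proof -
  define a b where "a = nat n" and "b = nat (- k - 1)"
  have eqs: "n - k = int (a + Suc b)" "nat n = a" "n = int a" "k = - int b - 1"
    using assms by (auto simp: a_def b_def)
  have sign: "even k \<longleftrightarrow> odd b" unfolding eqs(4) by simp
  show ?thesis
    unfolding roman_coeff_def power_int_minus_left sign eqs(1,2) nat_int real_binomial_add
    unfolding eqs(3,4) roman_factorial_of_nat roman_factorial_neg
    by (simp add: minus_one_power_iff divide_simps)
qed

lemma roman_coeff_region6:
  assumes "0 > k" "k > n"
  shows "roman_coeff n k = 1 / (real_of_int k * real (nat (- n - 1) choose nat (- k)))"
proof -
  define a b where "a = nat (- k - 1)" and "b = nat (k - n - 1)"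
  have eqs: "n - k = - int b - 1" "nat (- k) = Suc a" "nat (- n - 1) = Suc a + b"
    "k = - int a - 1" "n = - int (Suc a + b) - 1"
    using assms by (auto simp: a_def b_def)
  show ?thesis
    unfolding roman_coeff_def eqs(1,2,3) real_binomial_add
    unfolding eqs(4,5) roman_factorial_neg
    by (simp add: minus_one_power_iff divide_simps) (simp add: algebra_simps)
qed

section \<open>Knuth coefficients in the six regions\<close>

lemma knuth_coeff_regions:
  fixes \<epsilon> :: "'a::real_field" and n k :: int
  assumes "\<epsilon> \<noteq> 0"
  shows
    "(n \<ge> k \<and> k \<ge> 0 \<longrightarrow>
         knuth_coeff \<epsilon> (of_int n) (of_int k) = of_nat (nat n choose nat k) \<and>
         knuth_coeff \<epsilon> (of_int n) (of_int k) = of_real (roman_coeff n k)) \<and>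
      (k \<ge> 0 \<and> 0 > n \<longrightarrow>
         knuth_coeff \<epsilon> (of_int n) (of_int k) = (- 1) powi k * of_nat (nat (- n + k - 1) choose nat k) \<and>
         knuth_coeff \<epsilon> (of_int n) (of_int k) = of_real (roman_coeff n k)) \<and>
      (0 > n \<and> n \<ge> k \<longrightarrow>
         knuth_coeff \<epsilon> (of_int n) (of_int k) = (- 1) powi (n + k) * of_nat (nat (- k - 1) choose nat (n - k)) \<and>
         knuth_coeff \<epsilon> (of_int n) (of_int k) = of_real (roman_coeff n k)) \<and>
      (k > n \<and> n \<ge> 0 \<longrightarrow>
         knuth_coeff \<epsilon> (of_int n) (of_int k) = (- 1) powi (n + k) * \<epsilon> / (of_int (n - k) * of_nat (nat k choose nat n)) \<and>
         knuth_coeff \<epsilon> (of_int n) (of_int k) = \<epsilon> * of_real (roman_coeff n k)) \<and>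
      (n \<ge> 0 \<and> 0 > k \<longrightarrow>
         knuth_coeff \<epsilon> (of_int n) (of_int k) = (- 1) powi k * \<epsilon> / (of_int k * of_nat (nat (n - k) choose nat n)) \<and>
         knuth_coeff \<epsilon> (of_int n) (of_int k) = \<epsilon> * of_real (roman_coeff n k)) \<and>
      (0 > k \<and> k > n \<longrightarrow>
         knuth_coeff \<epsilon> (of_int n) (of_int k) = \<epsilon> / (of_int k * of_nat (nat (- n - 1) choose nat (- k))) \<and>
         knuth_coeff \<epsilon> (of_int n) (of_int k) = \<epsilon> * of_real (roman_coeff n k))"
  using assms
  by (auto simp: knuth_coeff_of_int roman_coeff_region1 roman_coeff_region2 roman_coeff_region3
      roman_coeff_region4 roman_coeff_region5 roman_coeff_region6 mult.commute power2_eq_square)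

theorem proposition1p13:
  fixes n k :: int
  shows
    "(\<forall>\<epsilon> :: complex. \<epsilon> \<noteq> 0 \<longrightarrow>
      (n \<ge> k \<and> k \<ge> 0 \<longrightarrow>
         knuth_coeff \<epsilon> (of_int n) (of_int k) = of_nat (nat n choose nat k) \<and>
         knuth_coeff \<epsilon> (of_int n) (of_int k) = of_real (roman_coeff n k)) \<and>
      (k \<ge> 0 \<and> 0 > n \<longrightarrow>
         knuth_coeff \<epsilon> (of_int n) (of_int k) = (- 1) powi k * of_nat (nat (- n + k - 1) choose nat k) \<and>
         knuth_coeff \<epsilon> (of_int n) (of_int k) = of_real (roman_coeff n k)) \<and>
      (0 > n \<and> n \<ge> k \<longrightarrow>
         knuth_coeff \<epsilon> (of_int n) (of_int k) = (- 1) powi (n + k) * of_nat (nat (- k - 1) choose nat (n - k)) \<and>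
         knuth_coeff \<epsilon> (of_int n) (of_int k) = of_real (roman_coeff n k)) \<and>
      (k > n \<and> n \<ge> 0 \<longrightarrow>
         knuth_coeff \<epsilon> (of_int n) (of_int k) = (- 1) powi (n + k) * \<epsilon> / (of_int (n - k) * of_nat (nat k choose nat n)) \<and>
         knuth_coeff \<epsilon> (of_int n) (of_int k) = \<epsilon> * of_real (roman_coeff n k)) \<and>
      (n \<ge> 0 \<and> 0 > k \<longrightarrow>
         knuth_coeff \<epsilon> (of_int n) (of_int k) = (- 1) powi k * \<epsilon> / (of_int k * of_nat (nat (n - k) choose nat n)) \<and>
         knuth_coeff \<epsilon> (of_int n) (of_int k) = \<epsilon> * of_real (roman_coeff n k)) \<and>
      (0 > k \<and> k > n \<longrightarrow>
         knuth_coeff \<epsilon> (of_int n) (of_int k) = \<epsilon> / (of_int k * of_nat (nat (- n - 1) choose nat (- k))) \<and>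
         knuth_coeff \<epsilon> (of_int n) (of_int k) = \<epsilon> * of_real (roman_coeff n k))) \<and>
     (\<forall>\<epsilon> :: 'i::infinite surreal. \<epsilon> \<noteq> 0 \<longrightarrow>
      (n \<ge> k \<and> k \<ge> 0 \<longrightarrow>
         knuth_coeff \<epsilon> (of_int n) (of_int k) = of_nat (nat n choose nat k) \<and>
         knuth_coeff \<epsilon> (of_int n) (of_int k) = of_real (roman_coeff n k)) \<and>
      (k \<ge> 0 \<and> 0 > n \<longrightarrow>
         knuth_coeff \<epsilon> (of_int n) (of_int k) = (- 1) powi k * of_nat (nat (- n + k - 1) choose nat k) \<and>
         knuth_coeff \<epsilon> (of_int n) (of_int k) = of_real (roman_coeff n k)) \<and>
      (0 > n \<and> n \<ge> k \<longrightarrow>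
         knuth_coeff \<epsilon> (of_int n) (of_int k) = (- 1) powi (n + k) * of_nat (nat (- k - 1) choose nat (n - k)) \<and>
         knuth_coeff \<epsilon> (of_int n) (of_int k) = of_real (roman_coeff n k)) \<and>
      (k > n \<and> n \<ge> 0 \<longrightarrow>
         knuth_coeff \<epsilon> (of_int n) (of_int k) = (- 1) powi (n + k) * \<epsilon> / (of_int (n - k) * of_nat (nat k choose nat n)) \<and>
         knuth_coeff \<epsilon> (of_int n) (of_int k) = \<epsilon> * of_real (roman_coeff n k)) \<and>
      (n \<ge> 0 \<and> 0 > k \<longrightarrow>
         knuth_coeff \<epsilon> (of_int n) (of_int k) = (- 1) powi k * \<epsilon> / (of_int k * of_nat (nat (n - k) choose nat n)) \<and>
         knuth_coeff \<epsilon> (of_int n) (of_int k) = \<epsilon> * of_real (roman_coeff n k)) \<and>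
      (0 > k \<and> k > n \<longrightarrow>
         knuth_coeff \<epsilon> (of_int n) (of_int k) = \<epsilon> / (of_int k * of_nat (nat (- n - 1) choose nat (- k))) \<and>
         knuth_coeff \<epsilon> (of_int n) (of_int k) = \<epsilon> * of_real (roman_coeff n k)))"
  by (intro conjI[OF allI allI] impI; erule knuth_coeff_regions)

end
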